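(* For any finite simple graphs $G$ and $H$, $$\lambda(G \times H) = \min\{\,2\lambda(G)|E(H)|,\; 2\lambda(H)|E(G)|,\; \delta(G \times H),\; \psi(G, H),\; \psi(H, G)\,\}.$$
   Context: The direct product $G\times H$ has vertex set $V(G)\times V(H)$, with $(x_1,y_1)$ adjacent to $(x_2,y_2)$ if and only if $x_1x_2\in E(G)$ and $y_1y_2\in E(H)$. An edge-cut of a graph $F$ is a set $S\subseteq E(F)$ such that $F-S$ is disconnected; $\lambda(F)$ (the edge connectivity) is the size of a minimum edge-cut of $F$ (it is $0$ if $F$ is disconnected), and $\delta(F)$ is the minimum degree of $F$. The bipartite edge frustration $\varphi(F)$ is the minimum number of edges whose deletion from $F$ yields a bipartite graph. For $A,B\subseteq V(F)$, $[A,B]$ denotes the set of edges of $F$ with one endvertex in $A$ and the other in $B$, and $[A]$ denotes the subgraph of $F$ induced by $A$. Let $\mathcal{P}(V(F))$ be the set of all partitions $\{A,B\}$ of $V(F)$ into two subsets, one of which may be empty, and define $$\rho(F)=\min\{\,2\varphi([A])+|[A,B]| : \{A,B\}\in\mathcal{P}(V(F)),\ A\neq\emptyset\,\}.$$ For graphs $G,H$ define $\psi(G,H)=\rho(G)|E(H)|+2\varphi(H)|E(G)|$. *)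

theory Defs
  imports Main
begin

type_synonym 'a graph = "'a set \<times> 'a set set"

abbreviation verts :: "'a graph \<Rightarrow> 'a set" where "verts F \<equiv> fst F"
abbreviation edges :: "'a graph \<Rightarrow> 'a set set" where "edges F \<equiv> snd F"

definition finite_simple_graph :: "'a graph \<Rightarrow> bool" where
  "finite_simple_graph F \<longleftrightarrow> finite (verts F) \<and> verts F \<noteq> {} \<and>
     edges F \<subseteq> {{x, y} | x y. x \<in> verts F \<and> y \<in> verts F \<and> x \<noteq> y}"

definition direct_product :: "'a graph \<Rightarrow> 'b graph \<Rightarrow> ('a \<times> 'b) graph" where
  "direct_product G H = (verts G \<times> verts H,
     {{(x1, y1), (x2, y2)} | x1 x2 y1 y2. {x1, x2} \<in> edges G \<and> {y1, y2} \<in> edges H})"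

definition adj :: "'a graph \<Rightarrow> 'a \<Rightarrow> 'a \<Rightarrow> bool" where
  "adj F x y \<longleftrightarrow> {x, y} \<in> edges F"

definition connected_graph :: "'a graph \<Rightarrow> bool" where
  "connected_graph F \<longleftrightarrow> (\<forall>x\<in>verts F. \<forall>y\<in>verts F. (adj F)\<^sup>*\<^sup>* x y)"

text \<open>Edge connectivity: minimum size of an edge cut; 0 for graphs with at most one vertex
  (for which no edge cut exists). For disconnected graphs the empty set is a cut, giving 0.\<close>
definition edge_conn :: "'a graph \<Rightarrow> nat" where
  "edge_conn F = (if card (verts F) \<le> 1 then 0 else
     Min {card S | S. S \<subseteq> edges F \<and> \<not> connected_graph (verts F, edges F - S)})"

definition degree :: "'a graph \<Rightarrow> 'a \<Rightarrow> nat" where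
  "degree F v = card {e \<in> edges F. v \<in> e}"

definition min_degree :: "'a graph \<Rightarrow> nat" where
  "min_degree F = Min (degree F ` verts F)"

definition bipartite :: "'a graph \<Rightarrow> bool" where
  "bipartite F \<longleftrightarrow> (\<exists>A \<subseteq> verts F. \<forall>e\<in>edges F. card (e \<inter> A) = 1)"

definition frustration :: "'a graph \<Rightarrow> nat" where
  "frustration F = Min {card S | S. S \<subseteq> edges F \<and> bipartite (verts F, edges F - S)}"

definition induced :: "'a graph \<Rightarrow> 'a set \<Rightarrow> 'a graph" where
  "induced F A = (A, {e \<in> edges F. e \<subseteq> A})"

definition cut_edges :: "'a graph \<Rightarrow> 'a set \<Rightarrow> 'a set \<Rightarrow> 'a set set" where
  "cut_edges F A B = {e \<in> edges F. e \<inter> A \<noteq> {} \<and> e \<inter> B \<noteq> {}}"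

definition rho :: "'a graph \<Rightarrow> nat" where
  "rho F = Min {2 * frustration (induced F A) + card (cut_edges F A (verts F - A))
               | A. A \<subseteq> verts F \<and> A \<noteq> {}}"

definition psi :: "'a graph \<Rightarrow> 'b graph \<Rightarrow> nat" where
  "psi G H = rho G * card (edges H) + 2 * frustration H * card (edges G)"

end

theory Submission
  imports Defs
begin

text \<open>
  Every graph is replaced by its symmetric set of arcs (ordered adjacent pairs). A vertex set of
  \<open>G \<times> H\<close> is a function \<open>f x y\<close>, and its cut is measured by \<open>cost\<close>: the number of pairs of arcs
  \<open>(x, x')\<close>, \<open>(y, y')\<close> with \<open>f x y \<noteq> f x' y'\<close>, which is twice the number of cut edges.

  Upper bounds: cylinders over minimum cuts, a single vertex, and for \<open>\<psi>\<close> the better of the two sets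
  \<open>x \<in> A \<and> g x = h y\<close> and \<open>x \<in> A \<and> g x \<noteq> h y\<close> for optimal 2-colourings \<open>g\<close>, \<open>h\<close>.

  Lower bound, for connected \<open>G\<close> and \<open>H\<close> with minimum degrees \<open>d\<close> and \<open>e\<close>. If some rows (or columns)
  of \<open>f\<close> are constant with different values, each arc of the other factor costs at least twice the edge
  connectivity. Otherwise, after complementing, all constant rows and columns are false. If no row is
  constant and \<open>G\<close> is bipartite, each row arc costs at least \<open>\<rho>(H)\<close> or \<open>2\<lambda>(H)\<close>; dually for columns. In
  the remaining case every arc starting at a nonconstant row or column has positive cost, and \<open>2de\<close>
  is a lower bound: if there are at most \<open>d\<close> nonconstant rows, at least \<open>d\<close> edges leave them, each of
  cost at least \<open>e\<close> in both directions; if no arc has cost 1, the arcs starting at nonconstant rows give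
  \<open>2d(d+1)\<close> and those at columns \<open>2e(e+1)\<close>; and an arc of cost 1 forces a bridge of the other
  factor with a bipartite side, where a minimal such side contains enough arcs that are not bridges.
\<close>

subsection \<open>Cuts and 2-colourings in terms of arcs\<close>

definition boundary :: "('a \<times> 'a) set \<Rightarrow> 'a set \<Rightarrow> ('a \<times> 'a) set" where
  "boundary R A = {(x, y) \<in> R. x \<in> A \<and> y \<notin> A}"

text \<open>For an arc \<open>(x, x')\<close> of one factor with rows \<open>p = f x\<close> and
  \<open>q = f x'\<close>, these are the arcs of the other factor that complete it to an arc of the
  product across the cut.\<close>

definition discord :: "('a \<times> 'a) set \<Rightarrow> ('a \<Rightarrow> bool) \<Rightarrow> ('a \<Rightarrow> bool) \<Rightarrow> ('a \<times> 'a) set" where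
  "discord R p q = {(x, y) \<in> R. p x \<noteq> q y}"

text \<open>A monochromatic edge counts twice here and a cut edge once in \<open>boundary\<close>;
  these are the weights 2 and 1 occurring in \<open>rho\<close>.\<close>

definition mono_arcs :: "('a \<times> 'a) set \<Rightarrow> 'a set \<Rightarrow> ('a \<Rightarrow> bool) \<Rightarrow> ('a \<times> 'a) set" where
  "mono_arcs R A g = {(x, y) \<in> R. x \<in> A \<and> y \<in> A \<and> g x = g y}"

text \<open>A bridge is the only edge of some cut; admitting both orientations makes the notion
  symmetric in \<open>u\<close> and \<open>v\<close>.\<close>

definition bridge :: "('a \<times> 'a) set \<Rightarrow> 'a \<Rightarrow> 'a \<Rightarrow> bool" where
  "bridge R u v \<longleftrightarrow> (\<exists>T. boundary R T = {(u, v)} \<or> boundary R T = {(v, u)})"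

lemma card_arcs_eq_sum:
  "finite R \<Longrightarrow> card {(x, y) \<in> R. P x y} = (\<Sum>(x, y)\<in>R. of_bool (P x y))"
proof -
  assume "finite R"
  have "(\<Sum>(x, y)\<in>R. of_bool (P x y)) = (\<Sum>z\<in>R. if P (fst z) (snd z) then 1 else (0::nat))"
    by (rule sum.cong) auto
  also have "\<dots> = card {z\<in>R. P (fst z) (snd z)}"
    using \<open>finite R\<close> by (simp add: sum.If_cases Int_def)
  also have "{z\<in>R. P (fst z) (snd z)} = {(x, y) \<in> R. P x y}" by auto
  finally show ?thesis by simp
qed

lemma sum_arcs_swap:
  fixes g :: "'a \<Rightarrow> 'a \<Rightarrow> nat"
  assumes "sym R"
  shows "(\<Sum>(x, y)\<in>R. g x y) = (\<Sum>(x, y)\<in>R. g y x)"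
  by (rule sum.reindex_bij_witness[where i = prod.swap and j = prod.swap])
     (use assms in \<open>auto dest: symD\<close>)

lemma sum_mono_arcs:
  fixes g h :: "'a \<times> 'a \<Rightarrow> nat"
  assumes "\<And>x y. g (x, y) \<le> h (x, y)"
  shows "sum g R \<le> sum h R"
  by (rule sum_mono) (use assms in force)

text \<open>Averaging over both orientations reduces inequalities between arc counts to a check on
  one edge at a time, by cases on truth values.\<close>

lemma two_card_arcs:
  assumes "finite R" "sym R"
  shows "2 * card {(x, y) \<in> R. P x y} = (\<Sum>(x, y)\<in>R. of_bool (P x y) + of_bool (P y x))"
proof -
  have "2 * card {(x, y) \<in> R. P x y} = (\<Sum>(x, y)\<in>R. of_bool (P x y)) + (\<Sum>(x, y)\<in>R. of_bool (P y x))"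
    using sum_arcs_swap[OF assms(2), of "\<lambda>x y. of_bool (P x y)"] card_arcs_eq_sum[OF assms(1), of P]
    by linarith
  then show ?thesis unfolding split_def sum.distrib .
qed

text \<open>Let \<open>D\<close> be the set where \<open>p\<close> and \<open>q\<close> differ. An
  edge leaving \<open>D\<close> is discordant in exactly one orientation, and an arc inside
  \<open>D\<close> exactly when \<open>p\<close> agrees at its ends. Arcs outside \<open>D\<close>
  are dropped.\<close>

lemma discord_ge_boundary_mono:
  assumes "finite R" "sym R"
  shows "card (boundary R {x. p x \<noteq> q x}) + card (mono_arcs R {x. p x \<noteq> q x} p) \<le> card (discord R p q)"
proof -
  have "2 * card (boundary R {x. p x \<noteq> q x}) + 2 * card (mono_arcs R {x. p x \<noteq> q x} p)
      \<le> 2 * card (discord R p q)"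
    unfolding boundary_def mono_arcs_def discord_def two_card_arcs[OF assms] sum.distrib[symmetric]
    by (rule sum_mono_arcs, case_tac "p x"; case_tac "p y"; case_tac "q x"; case_tac "q y"; simp)
  then show ?thesis by simp
qed

text \<open>An edge leaving one of the two sets is discordant in at least one orientation, and an
  edge joining them in both.\<close>

lemma discord_ge_two_boundaries:
  assumes "finite R" "sym R"
  shows "card (boundary R {x. p x \<and> q x}) + card (boundary R {x. \<not> p x \<and> \<not> q x}) \<le> card (discord R p q)"
proof -
  have "2 * card (boundary R {x. p x \<and> q x}) + 2 * card (boundary R {x. \<not> p x \<and> \<not> q x})
      \<le> 2 * card (discord R p q)"
    unfolding boundary_def discord_def two_card_arcs[OF assms] sum.distrib[symmetric]
    by (rule sum_mono_arcs, case_tac "p x"; case_tac "p y"; case_tac "q x"; case_tac "q y"; simp)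
  then show ?thesis by simp
qed

text \<open>Submodularity of the cut function, used below to uncross two cuts of size 1.\<close>

lemma boundary_submodular:
  assumes "finite R"
  shows "card (boundary R (S \<inter> T)) + card (boundary R (S \<union> T)) \<le> card (boundary R S) + card (boundary R T)"
  unfolding boundary_def card_arcs_eq_sum[OF assms] sum.distrib[symmetric]
  by (rule sum_mono_arcs, case_tac "x \<in> S"; case_tac "y \<in> S"; case_tac "x \<in> T"; case_tac "y \<in> T"; simp)

lemma boundary_compl: "sym R \<Longrightarrow> boundary R (- T) = (boundary R T)\<inverse>"
  by (auto simp: boundary_def dest: symD)

lemma card_discord_commute:
  assumes "finite R" "sym R"
  shows "card (discord R p q) = card (discord R q p)"
  using sum_arcs_swap[OF assms(2), of "\<lambda>x y. of_bool (p x \<noteq> q y)"]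
  by (simp add: discord_def card_arcs_eq_sum assms eq_commute)

section \<open>Connected graphs: rows at distance 0 or 1, and bridges\<close>

locale arc_graph =
  fixes V :: "'a set" and R :: "('a \<times> 'a) set"
  assumes finV: "finite V" and RV: "R \<subseteq> V \<times> V" and symR: "sym R" and irreflR: "irrefl R"
begin

lemma finR: "finite R"
  using finV RV finite_subset by blast

lemma boundary_Int: "boundary R (A \<inter> V) = boundary R A"
  using RV by (auto simp: boundary_def)

end

locale connected_arc_graph = arc_graph +
  assumes conn: "\<And>A. A \<subseteq> V \<Longrightarrow> A \<noteq> {} \<Longrightarrow> A \<noteq> V \<Longrightarrow> boundary R A \<noteq> {}"
begin

lemma boundary_ne:
  assumes "x \<in> V" "x \<in> A" "y \<in> V" "y \<notin> A"
  shows "boundary R A \<noteq> {}"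
  using conn[of "A \<inter> V"] assms by (auto simp: boundary_Int)

lemma finite_boundary: "finite (boundary R A)"
  using finR by (rule finite_subset[rotated]) (auto simp: boundary_def)

lemma finite_discord: "finite (discord R p q)"
  using finR by (rule finite_subset[rotated]) (auto simp: discord_def)

text \<open>The set where \<open>p\<close> and \<open>q\<close> differ has no boundary, so it is
  empty or everything. If it were empty, the cut around a colour class of the nonconstant
  \<open>p\<close> would be discordant. Hence \<open>q\<close> is the complement of
  \<open>p\<close>, and then discordant arcs are the monochromatic ones.\<close>

lemma discord_eq_0:
  assumes "discord R p q = {}" "x \<in> V" "y \<in> V" "p x \<noteq> p y"
  shows "\<forall>x\<in>V. p x \<noteq> q x" and "mono_arcs R V p = {}"
proof -
  have b: "boundary R {x. p x \<noteq> q x} = {}"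
    using discord_ge_boundary_mono[OF finR symR, of p q] assms(1) finite_boundary by simp
  show *: "\<forall>x\<in>V. p x \<noteq> q x"
  proof (rule ccontr)
    assume "\<not> ?thesis"
    then obtain w where w: "w \<in> V" "w \<notin> {x. p x \<noteq> q x}" by blast
    have pq: "p z = q z" if "z \<in> V" for z using b boundary_ne[of z "{x. p x \<noteq> q x}" w] w that by fast
    have "boundary R {z. p z = p x} \<subseteq> discord R p q"
    proof (rule subrelI)
      fix u v assume "(u, v) \<in> boundary R {z. p z = p x}"
      then have "(u, v) \<in> R" "v \<in> V" "p u \<noteq> p v" using RV unfolding boundary_def by fast+
      then show "(u, v) \<in> discord R p q" using pq[of v] by (simp add: discord_def)
    qed
    then show False using boundary_ne[of x "{z. p z = p x}" y] assms by simp
  qed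
  show "mono_arcs R V p = {}"
  proof (rule ccontr)
    assume "mono_arcs R V p \<noteq> {}"
    then obtain u v where uv: "(u, v) \<in> R" "p u = p v" "v \<in> V"
      by (auto simp: mono_arcs_def)
    then have "(u, v) \<in> discord R p q" using * by (simp add: discord_def)
    then show False using assms(1) by simp
  qed
qed

text \<open>The reversal of the only discordant arc is not discordant, so exactly one of its ends
  lies in \<open>A\<close>. Thus \<open>A\<close> has a nonempty boundary, which uses up the whole
  of \<open>discord_ge_boundary_mono\<close>: one edge leaves \<open>A\<close>, and \<open>p\<close>
  properly colours the inside.\<close>

lemma discord_eq_1:
  assumes "card (discord R p q) = 1" and A: "A = {x \<in> V. p x \<noteq> q x}"
  shows "A \<noteq> {}" "A \<noteq> V" "card (boundary R A) = 1" "mono_arcs R A p = {}"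
    "(u, v) \<in> discord R p q \<Longrightarrow> bridge R u v"
proof -
  obtain a b where D: "discord R p q = {(a, b)}"
    using assms(1) by (metis card_1_singletonE surj_pair)
  have "(a, b) \<in> discord R p q" using D by simp
  then have ab: "(a, b) \<in> R" "(b, a) \<in> R" "a \<noteq> b" "p a \<noteq> q b" "a \<in> V" "b \<in> V"
    using symR irreflR RV by (auto simp: discord_def dest: symD irreflD)
  have nba: "p b = q a"
  proof (rule ccontr)
    assume "p b \<noteq> q a"
    then have "(b, a) \<in> discord R p q" using ab(2) by (simp add: discord_def)
    then show False using D ab(3) by simp
  qed
  have in_A: "z \<in> A \<longleftrightarrow> p z \<noteq> q z" if "z \<in> V" for z using A that by simp
  show Ane: "A \<noteq> {}" and AV: "A \<noteq> V"
    using in_A[OF ab(5)] in_A[OF ab(6)] nba ab(4-6) by (metis emptyE, metis)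
  have bA: "boundary R A = boundary R {x. p x \<noteq> q x}"
    using boundary_Int[of "{x. p x \<noteq> q x}"] by (simp add: A Int_def conj_commute)
  have "card (boundary R A) \<noteq> 0" using conn[of A] Ane AV finite_boundary A by auto
  then show c1: "card (boundary R A) = 1" 
    using discord_ge_boundary_mono[OF finR symR, of p q] assms(1) bA by simp
  have "card (mono_arcs R {x. p x \<noteq> q x} p) = 0"
    using c1 discord_ge_boundary_mono[OF finR symR, of p q] assms(1) bA by simp
  moreover have "finite (mono_arcs R {x. p x \<noteq> q x} p)"
    using finR by (rule finite_subset[rotated]) (auto simp: mono_arcs_def)
  ultimately have "mono_arcs R {x. p x \<noteq> q x} p = {}" by simp
  then show "mono_arcs R A p = {}" unfolding mono_arcs_def A by fast
  assume "(u, v) \<in> discord R p q"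
  then have uv: "u = a" "v = b" using D by auto
  have "boundary R A \<subseteq> {(a, b), (b, a)}"
  proof (rule subrelI)
    fix x y assume xy: "(x, y) \<in> boundary R A"
    have "(x, y) \<in> R" "(y, x) \<in> R" "p x \<noteq> q x" "p y = q y"
      using xy RV symD[OF symR, of x y] unfolding boundary_def A by fast+
    then have "(x, y) \<in> discord R p q \<or> (y, x) \<in> discord R p q"
      by (cases "p x"; cases "p y"; simp add: discord_def)
    then show "(x, y) \<in> {(a, b), (b, a)}" using D by auto
  qed
  moreover obtain z where "boundary R A = {z}" using c1 card_1_singletonE by blast
  ultimately show "bridge R u v" unfolding bridge_def uv by auto
qed

text \<open>A side of least cardinality works. If a bridge lay inside it, uncrossing with a side
  \<open>T\<close> of that bridge that misses some vertex outside \<open>S0\<close> would give the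
  smaller side \<open>S0 \<inter> T\<close>.\<close>

lemma minimal_bridge_side:
  assumes "S \<subseteq> V" "S \<noteq> {}" "S \<noteq> V" "card (boundary R S) = 1"
  obtains S0 where "S0 \<subseteq> S" "S0 \<noteq> {}" "S0 \<noteq> V" "card (boundary R S0) = 1"
    "\<And>u v. (u, v) \<in> R \<Longrightarrow> u \<in> S0 \<Longrightarrow> v \<in> S0 \<Longrightarrow> \<not> bridge R u v"
proof -
  let ?P = "\<lambda>T. T \<subseteq> S \<and> T \<noteq> {} \<and> T \<noteq> V \<and> card (boundary R T) = 1"
  obtain S0 where S0: "?P S0" and min: "\<And>T. ?P T \<Longrightarrow> card S0 \<le> card T"
    using ex_has_least_nat[of ?P S card] assms by blast
  have S0V: "S0 \<subseteq> V" using S0 assms(1) by blast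
  have nb: False if uv: "u \<in> S0" "v \<in> S0" and T: "boundary R T = {(u, v)}"
    and b: "b \<in> V" "b \<notin> S0" "b \<notin> T" for u v T b
  proof -
    have "(u, v) \<in> boundary R T" using T by simp
    then have "u \<in> T" "v \<notin> T" by (simp_all add: boundary_def)
    then have "boundary R (S0 \<inter> T) \<noteq> {}" "boundary R (S0 \<union> T) \<noteq> {}"
      using boundary_ne[of u "S0 \<inter> T" b] boundary_ne[of u "S0 \<union> T" b] b uv S0V by simp_all blast+
    then have "card (boundary R (S0 \<inter> T)) \<noteq> 0" "card (boundary R (S0 \<union> T)) \<noteq> 0"
      using finite_boundary by simp_all
    moreover have "card (boundary R (S0 \<inter> T)) + card (boundary R (S0 \<union> T)) \<le> 2"
      using boundary_submodular[OF finR, of S0 T] S0 T by simp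
    ultimately have "card (boundary R (S0 \<inter> T)) = 1" by linarith
    moreover have "S0 \<inter> T \<subseteq> S" "S0 \<inter> T \<noteq> {}" "S0 \<inter> T \<noteq> V" using S0 S0V b \<open>u \<in> T\<close> uv by auto
    ultimately have "?P (S0 \<inter> T)" by simp
    moreover have "card (S0 \<inter> T) < card S0"
      using \<open>v \<notin> T\<close> uv finite_subset[OF S0V finV] by (intro psubset_card_mono) auto
    ultimately show False using min[of "S0 \<inter> T"] by simp
  qed
  obtain b where b: "b \<in> V" "b \<notin> S0" using S0 S0V by blast
  have "\<not> bridge R u v" if uv: "u \<in> S0" "v \<in> S0" for u v
  proof
    assume "bridge R u v"
    then obtain T u' v' where T: "boundary R T = {(u', v')}" "u' \<in> S0" "v' \<in> S0"
      using uv unfolding bridge_def by blast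
    \<comment> \<open>One of \<open>T\<close> and \<open>- T\<close> misses \<open>b\<close>, so
      that \<open>nb\<close> applies to it.\<close>
    have "boundary R (- T) = {(v', u')}" using T(1) boundary_compl[OF symR, of T] by auto
    then show False
      using nb[OF T(2,3,1) b] nb[OF T(3,2) \<open>boundary R (- T) = {(v', u')}\<close> b] by blast
  qed
  then show thesis using that S0 by blast
qed

text \<open>Only \<open>a\<close> has a neighbour outside \<open>S\<close>. A vertex of one colour
  class other than \<open>a\<close> therefore has all its neighbours in the other class, so both
  classes have at least \<open>d\<close> elements. The arcs from \<open>P'\<close> to
  \<open>P\<close> number at least \<open>d * d\<close>, and reversal doubles them.\<close>

lemma many_arcs_in_bipartite_bridge_side:
  assumes S: "S \<subseteq> V" "card (boundary R S) = 1" and p: "mono_arcs R S p = {}"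
    and d: "\<And>x. x \<in> V \<Longrightarrow> d \<le> card (R `` {x})" and "2 \<le> d"
  shows "2 * d * d \<le> card {(x, y) \<in> R. x \<in> S \<and> y \<in> S}"
proof -
  obtain a b where ab: "boundary R S = {(a, b)}" using S(2) by (metis card_1_singletonE surj_pair)
  have finN: "finite (R `` {x})" for x using finR by simp
  have "(a, b) \<in> boundary R S" using ab by simp
  then have aS: "a \<in> S" "b \<notin> S" by (simp_all add: boundary_def)
  have N: "y \<in> S" if "x \<in> S" "(x, y) \<in> R" "x \<noteq> a \<or> y \<noteq> b" for x y
  proof (rule ccontr)
    assume "y \<notin> S"
    then have "(x, y) \<in> boundary R S" using that by (simp add: boundary_def)
    then show False using ab that by simp
  qed
  have alt: "p x \<noteq> p y" if "x \<in> S" "y \<in> S" "(x, y) \<in> R" for x y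
  proof
    assume "p x = p y"
    then have "(x, y) \<in> mono_arcs R S p" using that by (simp add: mono_arcs_def)
    then show False using p by simp
  qed
  define P where "P = {x \<in> S. p x = p a}"
  define P' where "P' = {x \<in> S. p x \<noteq> p a}"
  have fin: "finite P" "finite P'" using finite_subset[OF S(1) finV] by (auto simp: P_def P'_def)
  have "\<not> R `` {a} \<subseteq> {b}"
  proof
    assume "R `` {a} \<subseteq> {b}"
    then have "card (R `` {a}) \<le> 1" using card_mono[of "{b}" "R `` {a}"] by simp
    moreover have "a \<in> V" using aS S by blast
    ultimately show False using d[of a] \<open>2 \<le> d\<close> by simp
  qed
  \<comment> \<open>Here \<open>2 \<le> d\<close> is used: \<open>a\<close> has a neighbour besides
    the outer end \<open>b\<close> of the bridge, and it shows that \<open>P'\<close> is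
    nonempty.\<close>
  then obtain c where c: "(a, c) \<in> R" "c \<noteq> b" by auto
  have N': "R `` {x} \<subseteq> P" if "x \<in> P'" for x
  proof
    fix y assume y: "y \<in> R `` {x}"
    have x: "x \<in> S" "p x \<noteq> p a" using that by (simp_all add: P'_def)
    then have "x \<noteq> a" by blast
    then have "y \<in> S" using N[of x y] x y by simp
    then show "y \<in> P" using alt[of x y] x y by (simp add: P_def)
  qed
  have "c \<in> S" using N[OF aS(1) c(1)] c(2) by simp
  then have "c \<in> P'" using alt[OF aS(1) _ c(1)] by (simp add: P'_def)
  then have "d \<le> card P" 
    using card_mono[OF fin(1) N'[of c]] d[of c] S \<open>c \<in> S\<close> by fastforce
  then have "\<not> P \<subseteq> {a}" using card_mono[of "{a}" P] \<open>2 \<le> d\<close> by auto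
  then obtain c' where c': "c' \<in> P" "c' \<noteq> a" by blast
  have c'S: "c' \<in> S" "p c' = p a" using c'(1) by (simp_all add: P_def)
  have "R `` {c'} \<subseteq> P'"
  proof
    fix y assume y: "y \<in> R `` {c'}"
    then have "y \<in> S" using N[of c' y] c'(2) c'S by simp
    then show "y \<in> P'" using alt[of c' y] c'S y by (simp add: P'_def)
  qed
  then have cP': "d \<le> card P'"
    using card_mono[OF fin(2), of "R `` {c'}"] d[of c'] c'S S by fastforce
  define B where "B = (SIGMA x:P'. R `` {x})"
  have "d \<le> card (R `` {x})" if "x \<in> P'" for x using d[of x] that S unfolding P'_def by blast
  then have "card P' * d \<le> (\<Sum>x\<in>P'. card (R `` {x}))"
    using sum_bounded_below[of P' d "\<lambda>x. card (R `` {x})"] by simp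
  then have "card P' * d \<le> card B" unfolding B_def
    using fin finN by simp
  then have B: "d * d \<le> card B" using cP' by (meson le_trans mult_le_mono1)
  have BP: "B \<subseteq> P' \<times> P" unfolding B_def using N' by blast
  have finB: "finite B" using BP fin finite_subset by blast
  have cB: "card (B \<union> B\<inverse>) = card B + card (B\<inverse>)"
  proof (rule card_Un_disjoint)
    have "P \<inter> P' = {}" by (auto simp: P_def P'_def)
    then show "B \<inter> B\<inverse> = {}" using BP by blast
  qed (use finB in simp_all)
  have "B \<union> B\<inverse> \<subseteq> {(x, y) \<in> R. x \<in> S \<and> y \<in> S}"
  proof -
    have "P \<union> P' \<subseteq> S" by (auto simp: P_def P'_def)
    moreover have "B \<subseteq> R" "B\<inverse> \<subseteq> R" unfolding B_def using symR by (auto dest: symD)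
    ultimately show ?thesis using BP by blast
  qed
  moreover have "finite {(x, y) \<in> R. x \<in> S \<and> y \<in> S}"
    by (rule finite_subset[OF _ finR]) auto
  ultimately have "card (B \<union> B\<inverse>) \<le> card {(x, y) \<in> R. x \<in> S \<and> y \<in> S}"
    by (intro card_mono)
  then show ?thesis using B by (simp add: cB card_inverse)
qed

end

section \<open>Arc counts from the minimum degree\<close>

context arc_graph
begin

lemma card_arcs_from:
  assumes "X \<subseteq> V" and d: "\<And>x. x \<in> V \<Longrightarrow> d \<le> card (R `` {x})"
  shows "card X * d \<le> card {(x, y) \<in> R. x \<in> X}"
proof -
  have "card X * d \<le> (\<Sum>x\<in>X. card (R `` {x}))"
    using sum_bounded_below[of X d "\<lambda>x. card (R `` {x})"] assms by auto
  also have "\<dots> = card (SIGMA x:X. R `` {x})"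
    using finite_subset[OF assms(1) finV] finR by simp
  also have "(SIGMA x:X. R `` {x}) = {(x, y) \<in> R. x \<in> X}" by auto
  finally show ?thesis .
qed

text \<open>In a set of \<open>k\<close> vertices each has at most \<open>k - 1\<close> neighbours
  inside, which leaves at least \<open>d - (k - 1)\<close> outside.\<close>

lemma small_set_boundary:
  assumes X: "X \<subseteq> V" "X \<noteq> {}" "card X \<le> d" and d: "\<And>x. x \<in> V \<Longrightarrow> d \<le> card (R `` {x})"
  shows "d \<le> card (boundary R X)"
proof -
  define k where "k = card X"
  have finX: "finite X" using finite_subset[OF X(1) finV] .
  have "1 \<le> k" using X finX by (simp add: k_def Suc_le_eq card_gt_0_iff)
  have deg: "d - (k - 1) \<le> card (R `` {x} - X)" if "x \<in> X" for x
  proof -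
    have "R `` {x} \<subseteq> (R `` {x} - X) \<union> (X - {x})" using irreflR by (auto dest: irreflD)
    then have "card (R `` {x}) \<le> card ((R `` {x} - X) \<union> (X - {x}))"
      using finR finX by (intro card_mono) auto
    also have "\<dots> \<le> card (R `` {x} - X) + card (X - {x})" by (rule card_Un_le)
    also have "card (X - {x}) = k - 1" using that finX by (simp add: k_def)
    finally show ?thesis using d[of x] that X by auto
  qed
  have "card X * (d - (k - 1)) \<le> (\<Sum>x\<in>X. card (R `` {x} - X))"
    using sum_bounded_below[of X "d - (k - 1)" "\<lambda>x. card (R `` {x} - X)"] deg by auto
  also have "\<dots> = card (SIGMA x:X. R `` {x} - X)"
    using finX finR by simp
  also have "(SIGMA x:X. R `` {x} - X) = boundary R X" by (auto simp: boundary_def)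
  finally have le: "k * (d - (k - 1)) \<le> card (boundary R X)" by (simp add: k_def)
  \<comment> \<open>These substitutions remove the truncated subtractions; what remains is
    \<open>k + i \<le> k * (i + 1)\<close>.\<close>
  obtain j where j: "k = Suc j" using \<open>1 \<le> k\<close> by (cases k) auto
  obtain i where i: "d = k + i" using X(3) k_def le_Suc_ex by blast
  have "d \<le> k * (d - (k - 1))" by (simp add: i j)
  then show ?thesis using le by simp
qed

end

subsection \<open>The cost of a vertex set of the product\<close>

definition cost :: "('a \<times> 'a) set \<Rightarrow> ('b \<times> 'b) set \<Rightarrow> ('a \<Rightarrow> 'b \<Rightarrow> bool) \<Rightarrow> nat" where
  "cost R Q f = (\<Sum>(x, x')\<in>R. card (discord Q (f x) (f x')))"

lemma cost_eq_double_sum: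
  assumes "finite Q"
  shows "cost R Q f = (\<Sum>(x, x')\<in>R. \<Sum>(y, y')\<in>Q. of_bool (f x y \<noteq> f x' y'))"
  unfolding cost_def discord_def card_arcs_eq_sum[OF assms] ..

text \<open>Double counting; it carries every statement on rows over to columns.\<close>

lemma cost_transpose:
  assumes "finite R" "finite Q"
  shows "cost R Q f = cost Q R (\<lambda>y x. f x y)"
  unfolding cost_eq_double_sum[OF assms(1)] cost_eq_double_sum[OF assms(2)] split_def
  by (rule sum.swap)

lemma cost_compl: "cost R Q (\<lambda>x y. \<not> f x y) = cost R Q f"
  by (simp add: cost_def discord_def)

lemma cost_ge_uniform:
  assumes "finite R" "\<And>x x'. (x, x') \<in> R \<Longrightarrow> c \<le> card (discord Q (f x) (f x'))"
  shows "c * card R \<le> cost R Q f"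
  unfolding cost_def using sum_bounded_below[of R c "\<lambda>(x, x'). card (discord Q (f x) (f x'))"] assms
  by (auto simp: mult.commute)

section \<open>Cuts whose constant rows and columns are all false\<close>

text \<open>This is the case left for the degree bound. Since \<open>mono_arcs R V g = {}\<close>
  says that \<open>g\<close> is a proper 2-colouring, \<open>notG\<close> means that some row is
  constant or the first factor is not bipartite, and \<open>notH\<close> is its dual.\<close>

locale product_cut = G: connected_arc_graph V R + H: connected_arc_graph U Q
  for V :: "'a set" and R and U :: "'b set" and Q +
  fixes f :: "'a \<Rightarrow> 'b \<Rightarrow> bool" and d e :: nat
  assumes row: "\<And>x. x \<in> V \<Longrightarrow> \<exists>y\<in>U. \<not> f x y"
    and col: "\<And>y. y \<in> U \<Longrightarrow> \<exists>x\<in>V. \<not> f x y"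
    and nonempty: "\<exists>x\<in>V. \<exists>y\<in>U. f x y"
    and degG: "\<And>x. x \<in> V \<Longrightarrow> d \<le> card (R `` {x})"
    and degH: "\<And>y. y \<in> U \<Longrightarrow> e \<le> card (Q `` {y})"
    and notG: "\<not> ((\<forall>x\<in>V. \<exists>y\<in>U. f x y) \<and> (\<exists>g. mono_arcs R V g = {}))"
    and notH: "\<not> ((\<forall>y\<in>U. \<exists>x\<in>V. f x y) \<and> (\<exists>h. mono_arcs Q U h = {}))"
begin

text \<open>By \<open>row\<close> these are the nonconstant rows.\<close>

definition X where "X = {x \<in> V. \<exists>y\<in>U. f x y}"

lemma transpose: "product_cut U Q V R (\<lambda>y x. f x y) e d"
  by unfold_locales (use row col nonempty degG degH notG notH in auto)

lemma X_sub: "X \<subseteq> V" by (auto simp: X_def)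

lemma X_ne: "X \<noteq> {}" using nonempty by (auto simp: X_def)

text \<open>Cost 0 would make \<open>f x'\<close> the complement of \<open>f x\<close> and the
  second factor bipartite. Every column would then have a true entry in one of these two rows,
  against \<open>notH\<close>.\<close>

lemma row_arc_pos:
  assumes "(x, x') \<in> R" "x \<in> X"
  shows "1 \<le> card (discord Q (f x) (f x'))"
proof (rule ccontr)
  assume "\<not> ?thesis"
  then have D: "discord Q (f x) (f x') = {}" using H.finite_discord by (simp add: not_le)
  obtain y y' where y: "y \<in> U" "f x y" "y' \<in> U" "\<not> f x y'"
    using assms row[of x] unfolding X_def by blast
  have "\<forall>y\<in>U. f x y \<noteq> f x' y" "mono_arcs Q U (f x) = {}"
    using H.discord_eq_0[OF D y(1,3)] y by auto
  then show False using notH assms G.RV by blast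
qed

text \<open>An arc leaving \<open>X\<close> ends in an all-false row, so a true entry
  \<open>y\<close> of its first row is discordant with every arc starting at \<open>y\<close>. Both
  orientations of each boundary edge are counted.\<close>

lemma cost_ge_small_X:
  assumes "card X \<le> d"
  shows "2 * d * e \<le> cost R Q f"
proof -
  let ?B = "boundary R X" and ?c = "\<lambda>(x, x'). card (discord Q (f x) (f x'))"
  have c: "e \<le> card (discord Q (f x) (f x'))" if xx: "(x, x') \<in> ?B" for x x'
  proof -
    obtain y where y: "y \<in> U" "f x y" using xx by (auto simp: boundary_def X_def)
    have "{y} \<times> Q `` {y} \<subseteq> discord Q (f x) (f x')"
      using xx y H.RV G.RV by (auto simp: boundary_def X_def discord_def)
    then have "card ({y} \<times> Q `` {y}) \<le> card (discord Q (f x) (f x'))"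
      using H.finite_discord by (rule card_mono[rotated])
    then show ?thesis using degH[OF y(1)] by (simp add: card_cartesian_product)
  qed
  have "e \<le> ?c z" if "z \<in> ?B \<union> ?B\<inverse>" for z
  proof -
    obtain x x' where z: "z = (x, x')" by (cases z)
    then have "(x, x') \<in> ?B \<or> (x', x) \<in> ?B" using that by simp
    then show ?thesis using c[of x x'] c[of x' x] z card_discord_commute[OF H.finR H.symR, of "f x" "f x'"]
      by auto
  qed
  then have "card (?B \<union> ?B\<inverse>) * e \<le> sum ?c (?B \<union> ?B\<inverse>)"
    using sum_bounded_below[of "?B \<union> ?B\<inverse>" e ?c] by auto
  also have "\<dots> \<le> cost R Q f" unfolding cost_def
    by (rule sum_mono2) (use G.finR G.symR in \<open>auto simp: boundary_def dest: symD\<close>)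
  also have "card (?B \<union> ?B\<inverse>) = 2 * card ?B"
  proof -
    have "?B \<inter> ?B\<inverse> = {}" by (auto simp: boundary_def)
    then show ?thesis using card_Un_disjoint[of ?B "?B\<inverse>"] G.finite_boundary[of X] by (simp add: card_inverse)
  qed
  finally have "2 * card ?B * e \<le> cost R Q f" .
  moreover have "d \<le> card ?B"
    using G.small_set_boundary[OF X_sub X_ne assms degG] by simp
  ultimately show ?thesis by (meson le_trans mult_le_mono1 mult_le_mono2)
qed

lemma cost_ge_by_rows:
  assumes "d < card X" "\<And>x x'. (x, x') \<in> R \<Longrightarrow> x \<in> X \<Longrightarrow> c \<le> card (discord Q (f x) (f x'))"
  shows "c * (d * (d + 1)) \<le> cost R Q f"
proof -
  let ?B = "{(x, x') \<in> R. x \<in> X}" and ?c = "\<lambda>(x, x'). card (discord Q (f x) (f x'))"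
  have "(d + 1) * d \<le> card X * d" using assms(1) by (intro mult_le_mono1) simp
  also have "\<dots> \<le> card ?B" by (rule G.card_arcs_from[OF X_sub degG])
  finally have "(d + 1) * d \<le> card ?B" .
  then have "c * (d * (d + 1)) \<le> card ?B * c" by (simp add: mult.commute)
  also have "\<dots> \<le> sum ?c ?B"
    using sum_bounded_below[of ?B c ?c] assms(2) by auto
  also have "\<dots> \<le> cost R Q f" unfolding cost_def
    by (rule sum_mono2) (use G.finR in auto)
  finally show ?thesis .
qed

text \<open>Two counts of the cost are added: by rows in \<open>e1\<close>, and by columns in
  \<open>e2\<close>, where the arcs in \<open>I\<close> are no bridges and so come on top of the
  bridges in \<open>Br\<close>. For \<open>2 \<le> e\<close> the sum yields
  \<open>d * d + e * e\<close>, which is at least \<open>2 * d * e\<close>.\<close>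

lemma cost_ge_bridge_row:
  assumes X: "d < card X" and "1 \<le> d" and ab: "(a, a') \<in> R" "card (discord Q (f a) (f a')) = 1"
  shows "2 * d * e \<le> cost R Q f"
proof -
  interpret T: product_cut U Q V R "\<lambda>y x. f x y" e d by (rule transpose)
  have cT: "cost Q R (\<lambda>y x. f x y) = cost R Q f"
    using cost_transpose[OF G.finR H.finR] by simp
  let ?c = "\<lambda>(x, x'). card (discord Q (f x) (f x'))"
  define M where "M = {(x, x') \<in> R. x \<in> X}"
  define M1 where "M1 = {r \<in> R. ?c r = 1}"
  have "(d + 1) * d \<le> card X * d" using X by (intro mult_le_mono1) simp
  also have "\<dots> \<le> card M" unfolding M_def by (rule G.card_arcs_from[OF X_sub degG])
  finally have cM: "(d + 1) * d \<le> card M" .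
  have "2 * card M = (\<Sum>r\<in>M. 2)" by simp
  also have "\<dots> \<le> (\<Sum>r\<in>M. ?c r + of_bool (r \<in> M1))"
  proof (rule sum_mono)
    fix r assume "r \<in> M"
    then have "1 \<le> ?c r" "r \<in> R" using row_arc_pos by (auto simp: M_def)
    then show "2 \<le> ?c r + of_bool (r \<in> M1)" by (auto simp: M1_def)
  qed
  also have "\<dots> \<le> (\<Sum>r\<in>R. ?c r + of_bool (r \<in> M1))"
    by (rule sum_mono2) (use G.finR in \<open>auto simp: M_def\<close>)
  also have "\<dots> = cost R Q f + card M1"
    using G.finR by (simp add: cost_def sum.distrib M1_def Int_def conj_commute)
  finally have e1: "2 * card M \<le> cost R Q f + card M1" .

  define A where "A = {y \<in> U. f a y \<noteq> f a' y}"
  note A = H.discord_eq_1[OF ab(2) A_def]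
  obtain S where S: "S \<subseteq> A" "S \<noteq> {}" "S \<noteq> U" "card (boundary Q S) = 1"
    "\<And>u v. (u, v) \<in> Q \<Longrightarrow> u \<in> S \<Longrightarrow> v \<in> S \<Longrightarrow> \<not> bridge Q u v"
    using H.minimal_bridge_side[OF _ A(1-3)] A_def by blast
  have SU: "S \<subseteq> U" using S(1) A_def by auto
  \<comment> \<open>In a column of \<open>A\<close> the rows \<open>a\<close> and \<open>a'\<close>
    differ, so one of them has a true entry there.\<close>
  have ST: "S \<subseteq> T.X" using S(1) ab(1) G.RV by (auto simp: A_def T.X_def)
  define Br where "Br = {(y, y') \<in> Q. bridge Q y y'}"
  define I where "I = {(y, y') \<in> Q. y \<in> S \<and> y' \<in> S}"
  let ?c' = "\<lambda>(y, y'). card (discord R (\<lambda>x. f x y) (\<lambda>x. f x y'))"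
  have finI: "finite I" "finite Br"
    by (rule finite_subset[OF _ H.finR], auto simp: I_def Br_def)+
  have BI: "Br \<inter> I = {}" using S(5) by (auto simp: Br_def I_def)
  have "card I \<le> sum ?c' I"
    using sum_bounded_below[of I 1 ?c'] T.row_arc_pos ST by (force simp: I_def)
  \<comment> \<open>The only discordance of a cost-1 arc sits on a bridge of \<open>Q\<close>;
    exchanging the sums collects these by bridges.\<close>
  moreover have "card M1 \<le> sum ?c' Br"
  proof -
    let ?D = "\<lambda>(x, x') (y, y'). of_bool (f x y \<noteq> f x' y') :: nat"
    have "(\<Sum>r\<in>M1. 1) \<le> (\<Sum>r\<in>M1. \<Sum>c\<in>Br. ?D r c)"
    proof (rule sum_mono)
      fix r assume "r \<in> M1"
      then obtain x x' where r: "r = (x, x')" "(x, x') \<in> R" "card (discord Q (f x) (f x')) = 1"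
        by (cases r) (auto simp: M1_def)
      obtain y y' where y: "(y, y') \<in> discord Q (f x) (f x')" 
        using r(3) by (metis card_1_singletonE insertI1 surj_pair)
      have "bridge Q y y'" using H.discord_eq_1(5)[OF r(3) refl y] .
      then have "(y, y') \<in> Br" "?D r (y, y') = 1" using y r by (auto simp: discord_def Br_def)
      then show "1 \<le> (\<Sum>c\<in>Br. ?D r c)"
        using member_le_sum[of "(y, y')" Br "?D r"] finI by auto
    qed
    also have "\<dots> \<le> (\<Sum>r\<in>R. \<Sum>c\<in>Br. ?D r c)"
      by (rule sum_mono2) (use G.finR in \<open>auto simp: M1_def\<close>)
    also have "\<dots> = (\<Sum>c\<in>Br. \<Sum>r\<in>R. ?D r c)" by (rule sum.swap)
    also have "\<dots> = sum ?c' Br"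
    proof (rule sum.cong)
      fix c :: "'b \<times> 'b"
      obtain y y' where "c = (y, y')" by (cases c)
      then show "(\<Sum>r\<in>R. ?D r c) = ?c' c"
        unfolding discord_def card_arcs_eq_sum[OF G.finR] by (simp add: split_def)
    qed simp
    finally show ?thesis by simp
  qed
  moreover have "sum ?c' Br + sum ?c' I \<le> cost R Q f"
  proof -
    have "sum ?c' Br + sum ?c' I = sum ?c' (Br \<union> I)"
      using finI BI by (simp add: sum.union_disjoint)
    also have "\<dots> \<le> sum ?c' Q"
      by (rule sum_mono2) (use H.finR in \<open>auto simp: Br_def I_def\<close>)
    finally show ?thesis using cT by (simp add: cost_def)
  qed
  ultimately have e2: "card M1 + card I \<le> cost R Q f" by linarith
  \<comment> \<open>Arcs of cost 1 only weaken \<open>e1\<close>, but each of them is paid for by a bridge of \<open>Q\<close> in \<open>e2\<close>.\<close>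
  from e1 e2 cM have main: "2 * ((d + 1) * d) + card I \<le> 2 * cost R Q f" by linarith
  show ?thesis
  proof (cases "2 \<le> e")
    case True
    have "mono_arcs Q S (f a) = {}" using A(4) S(1) by (auto simp: mono_arcs_def)
    then have "2 * e * e \<le> card I" unfolding I_def
      using H.many_arcs_in_bipartite_bridge_side[OF SU S(4) _ degH True] by blast
    then have "2 * (d * d) + 2 * (e * e) \<le> 2 * cost R Q f" using main by (simp add: algebra_simps)
    moreover have "2 * (d * e) \<le> d * d + e * e"
    proof -
      \<comment> \<open>The square is taken over the integers, where the difference is not
        truncated.\<close>
      have "0 \<le> (int d - int e) * (int d - int e)" by simp
      then have "2 * (int d * int e) \<le> int d * int d + int e * int e" by (simp add: algebra_simps)
      then have "int (2 * (d * e)) \<le> int (d * d + e * e)" by simp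
      then show ?thesis by (simp only: of_nat_le_iff)
    qed
    ultimately show ?thesis by (simp add: algebra_simps)
  next
    case False
    then have "2 * d * e \<le> 2 * d * 1" by (intro mult_le_mono) auto
    also have "\<dots> \<le> (d + 1) * d" using \<open>1 \<le> d\<close> by (simp add: algebra_simps)
    also have "\<dots> \<le> cost R Q f" using main by linarith
    finally show ?thesis .
  qed
qed

lemma cost_ge_degrees:
  assumes "1 \<le> d" "1 \<le> e"
  shows "2 * d * e \<le> cost R Q f"
proof -
  interpret T: product_cut U Q V R "\<lambda>y x. f x y" e d by (rule transpose)
  have cT: "cost Q R (\<lambda>y x. f x y) = cost R Q f"
    using cost_transpose[OF G.finR H.finR] by simp
  show ?thesis
  proof (cases "card X \<le> d \<or> card T.X \<le> e")
    case True
    then show ?thesis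
    proof
      assume "card X \<le> d" then show ?thesis by (rule cost_ge_small_X)
    next
      assume "card T.X \<le> e" then show ?thesis
        using T.cost_ge_small_X unfolding cT by (simp add: mult.commute mult.left_commute)
    qed
  next
    case False
    then have X: "d < card X" "e < card T.X" by auto
    show ?thesis
    proof (cases "\<exists>a a'. (a, a') \<in> R \<and> card (discord Q (f a) (f a')) = 1")
      case True
      then show ?thesis using cost_ge_bridge_row X assms by blast
    next
      case rows: False
      show ?thesis
      proof (cases "\<exists>b b'. (b, b') \<in> Q \<and> card (discord R (\<lambda>x. f x b) (\<lambda>x. f x b')) = 1")
        case True
        then obtain b b' where "(b, b') \<in> Q" "card (discord R (\<lambda>x. f x b) (\<lambda>x. f x b')) = 1" by blast
        then show ?thesis
          using T.cost_ge_bridge_row[OF X(2) assms(2), of b b'] unfolding cT by (simp add: mult.commute mult.left_commute)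
      next
        case cols: False
        have "2 * (d * (d + 1)) \<le> cost R Q f"
        proof (rule cost_ge_by_rows[OF X(1)])
          fix x x' assume "(x, x') \<in> R" "x \<in> X"
          then show "2 \<le> card (discord Q (f x) (f x'))" using row_arc_pos[of x x'] rows by fastforce
        qed
        moreover have "2 * (e * (e + 1)) \<le> cost Q R (\<lambda>y x. f x y)"
        proof (rule T.cost_ge_by_rows[OF X(2)])
          fix y y' assume "(y, y') \<in> Q" "y \<in> T.X"
          then show "2 \<le> card (discord R (\<lambda>x. f x y) (\<lambda>x. f x y'))"
            using T.row_arc_pos[of y y'] cols by fastforce
        qed
        \<comment> \<open>The row bound suffices if \<open>d\<close> is the larger degree, the
          column bound if \<open>e\<close> is.\<close>
        moreover have "d * e \<le> d * (d + 1) \<or> d * e \<le> e * (e + 1)"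
          using mult_le_mono2[of e "d + 1" d] mult_le_mono1[of d "e + 1" e] by (cases "d \<le> e") (auto simp: mult.commute)
        ultimately show ?thesis using cT by auto
      qed
    qed
  qed
qed

end

section \<open>The lower bound for every nontrivial cut\<close>

context arc_graph
begin

text \<open>A common true entry and a common false entry make both sets of
  \<open>discord_ge_two_boundaries\<close> nonempty and proper.\<close>

lemma discord_ge_two_cuts:
  assumes l: "\<And>A. A \<subseteq> V \<Longrightarrow> A \<noteq> {} \<Longrightarrow> A \<noteq> V \<Longrightarrow> l \<le> card (boundary R A)"
    and "x \<in> V" "p x" "q x" "y \<in> V" "\<not> p y" "\<not> q y"
  shows "2 * l \<le> card (discord R p q)"
proof -
  have "l \<le> card (boundary R ({z. p z \<and> q z} \<inter> V))" by (rule l) (use assms in auto)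
  moreover have "l \<le> card (boundary R ({z. \<not> p z \<and> \<not> q z} \<inter> V))" by (rule l) (use assms in auto)
  ultimately show ?thesis
    using discord_ge_two_boundaries[OF finR symR, of p q] unfolding boundary_Int by linarith
qed

text \<open>If the rows agree, a nonconstant row gives the two common entries. Otherwise the set
  where they differ, coloured by \<open>p\<close>, is admissible in \<open>rho\<close>; it may be
  all of \<open>V\<close>.\<close>

lemma discord_ge_min:
  assumes l: "\<And>A. A \<subseteq> V \<Longrightarrow> A \<noteq> {} \<Longrightarrow> A \<noteq> V \<Longrightarrow> l \<le> card (boundary R A)"
    and r: "\<And>A g. A \<subseteq> V \<Longrightarrow> A \<noteq> {} \<Longrightarrow> r \<le> card (boundary R A) + card (mono_arcs R A g)"
    and "x \<in> V" "p x" "y \<in> V" "\<not> p y"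
  shows "min r (2 * l) \<le> card (discord R p q)"
proof (cases "\<forall>z\<in>V. p z = q z")
  case True
  then have "2 * l \<le> card (discord R p q)"
    using discord_ge_two_cuts[OF l, of x p q y] assms(3-6) by simp
  then show ?thesis by simp
next
  case False
  let ?A = "{z. p z \<noteq> q z}"
  have "r \<le> card (boundary R (?A \<inter> V)) + card (mono_arcs R (?A \<inter> V) p)"
    by (rule r) (use False in auto)
  also have "mono_arcs R (?A \<inter> V) p = mono_arcs R ?A p"
    using RV unfolding mono_arcs_def by fast
  finally have "r \<le> card (discord R p q)"
    using discord_ge_boundary_mono[OF finR symR, of p q] unfolding boundary_Int by linarith
  then show ?thesis by simp
qed

end

text \<open>The numbers stand in pairs, one for each factor: \<open>d\<close>, \<open>e\<close> for
  minimum degrees, \<open>l\<close>, \<open>m\<close> for edge connectivities and \<open>r\<close>,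
  \<open>s\<close> for \<open>rho\<close>. They enter as lower bounds only.\<close>

locale product_bounds = G: connected_arc_graph V R + H: connected_arc_graph U Q
  for V :: "'a set" and R and U :: "'b set" and Q +
  fixes d e l m r s :: nat
  assumes degG: "\<And>x. x \<in> V \<Longrightarrow> d \<le> card (R `` {x})"
    and degH: "\<And>y. y \<in> U \<Longrightarrow> e \<le> card (Q `` {y})"
    and de: "1 \<le> d" "1 \<le> e"
    and cutG: "\<And>A. A \<subseteq> V \<Longrightarrow> A \<noteq> {} \<Longrightarrow> A \<noteq> V \<Longrightarrow> l \<le> card (boundary R A)"
    and cutH: "\<And>A. A \<subseteq> U \<Longrightarrow> A \<noteq> {} \<Longrightarrow> A \<noteq> U \<Longrightarrow> m \<le> card (boundary Q A)"
    and rhoG: "\<And>A g. A \<subseteq> V \<Longrightarrow> A \<noteq> {} \<Longrightarrow> r \<le> card (boundary R A) + card (mono_arcs R A g)"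
    and rhoH: "\<And>A g. A \<subseteq> U \<Longrightarrow> A \<noteq> {} \<Longrightarrow> s \<le> card (boundary Q A) + card (mono_arcs Q A g)"
begin

lemma cost_ge_const_columns:
  assumes "y \<in> U" "\<forall>x\<in>V. f x y" "y' \<in> U" "\<forall>x\<in>V. \<not> f x y'"
  shows "2 * m * card R \<le> cost R Q f"
proof (rule cost_ge_uniform[OF G.finR])
  fix x x' assume "(x, x') \<in> R"
  then have "x \<in> V" "x' \<in> V" using G.RV by auto
  then show "2 * m \<le> card (discord Q (f x) (f x'))"
    using H.discord_ge_two_cuts[OF cutH, of y "f x" "f x'" y'] assms by simp
qed

lemma cost_ge_no_const_rows:
  assumes "\<forall>x\<in>V. (\<exists>y\<in>U. f x y) \<and> (\<exists>y\<in>U. \<not> f x y)"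
  shows "s * card R \<le> cost R Q f \<or> 2 * m * card R \<le> cost R Q f"
proof -
  have "min s (2 * m) * card R \<le> cost R Q f"
  proof (rule cost_ge_uniform[OF G.finR])
    fix x x' assume "(x, x') \<in> R"
    then have "x \<in> V" using G.RV by auto
    then obtain y y' where "y \<in> U" "f x y" "y' \<in> U" "\<not> f x y'" using assms by blast
    then show "min s (2 * m) \<le> card (discord Q (f x) (f x'))"
      using H.discord_ge_min[OF cutH rhoH] by blast
  qed
  then show ?thesis by (cases "s \<le> 2 * m") (auto simp: min_def)
qed

lemma transpose: "product_bounds U Q V R e d m l s r"
  by unfold_locales (fact degG degH de cutG cutH rhoG rhoH)+

text \<open>The last two alternatives are the \<open>psi\<close> terms with one bipartite factor,
  whose frustration vanishes. All terms are doubled because arcs are counted instead of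
  edges.\<close>

lemma cost_lower_bound_oriented:
  assumes "\<And>x. x \<in> V \<Longrightarrow> \<exists>y\<in>U. \<not> f x y" "\<And>y. y \<in> U \<Longrightarrow> \<exists>x\<in>V. \<not> f x y" "\<exists>x\<in>V. \<exists>y\<in>U. f x y"
  shows "2 * l * card Q \<le> cost R Q f \<or> 2 * m * card R \<le> cost R Q f \<or> 2 * d * e \<le> cost R Q f \<or>
    (\<exists>h. mono_arcs Q U h = {}) \<and> r * card Q \<le> cost R Q f \<or>
    (\<exists>g. mono_arcs R V g = {}) \<and> s * card R \<le> cost R Q f"
proof -
  interpret T: product_bounds U Q V R e d m l s r by (rule transpose)
  have cT: "cost Q R (\<lambda>y x. f x y) = cost R Q f"
    using cost_transpose[OF G.finR H.finR] by simp
  consider (G) "\<forall>x\<in>V. \<exists>y\<in>U. f x y" "\<exists>g. mono_arcs R V g = {}"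
    | (H) "\<forall>y\<in>U. \<exists>x\<in>V. f x y" "\<exists>h. mono_arcs Q U h = {}"
    | (N) "\<not> ((\<forall>x\<in>V. \<exists>y\<in>U. f x y) \<and> (\<exists>g. mono_arcs R V g = {}))"
      "\<not> ((\<forall>y\<in>U. \<exists>x\<in>V. f x y) \<and> (\<exists>h. mono_arcs Q U h = {}))" by blast
  then show ?thesis
  proof cases
    case G
    then show ?thesis using cost_ge_no_const_rows[of f] assms(1) by blast
  next
    case H
    then have "r * card Q \<le> cost R Q f \<or> 2 * l * card Q \<le> cost R Q f"
      using T.cost_ge_no_const_rows[of "\<lambda>y x. f x y"] assms(2) unfolding cT by blast
    then show ?thesis using H(2) by blast
  next
    case N
    interpret product_cut V R U Q f d e
      by unfold_locales (fact assms N degG degH)+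
    show ?thesis using cost_ge_degrees[OF de] by blast
  qed
qed

theorem cost_lower_bound:
  assumes "x \<in> V" "y \<in> U" "f x y" "x' \<in> V" "y' \<in> U" "\<not> f x' y'"
  shows "2 * l * card Q \<le> cost R Q f \<or> 2 * m * card R \<le> cost R Q f \<or> 2 * d * e \<le> cost R Q f \<or>
    (\<exists>h. mono_arcs Q U h = {}) \<and> r * card Q \<le> cost R Q f \<or>
    (\<exists>g. mono_arcs R V g = {}) \<and> s * card R \<le> cost R Q f"
proof -
  interpret T: product_bounds U Q V R e d m l s r by (rule transpose)
  have cT: "cost Q R (\<lambda>y x. f x y) = cost R Q f"
    using cost_transpose[OF G.finR H.finR] by simp
  let ?TR = "\<exists>x\<in>V. \<forall>y\<in>U. f x y" and ?FR = "\<exists>x\<in>V. \<forall>y\<in>U. \<not> f x y"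
    and ?TC = "\<exists>y\<in>U. \<forall>x\<in>V. f x y" and ?FC = "\<exists>y\<in>U. \<forall>x\<in>V. \<not> f x y"
  \<comment> \<open>A true row and a false column cannot coexist, nor can a false row and a true
    column; this makes the cases exhaustive.\<close>
  consider (rows) ?TR ?FR | (cols) ?TC ?FC | (false) "\<not> ?TR" "\<not> ?TC" | (true) "\<not> ?FR" "\<not> ?FC"
    by blast
  then show ?thesis
  proof cases
    case rows
    then have "2 * l * card Q \<le> cost R Q f"
      using T.cost_ge_const_columns[where f = "\<lambda>y x. f x y"] unfolding cT by blast
    then show ?thesis by blast
  next
    case cols
    then show ?thesis using cost_ge_const_columns[where f = f] by blast
  next
    case false
    show ?thesis by (rule cost_lower_bound_oriented) (use false assms in blast)+
  next
    case true
    show ?thesis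
      using cost_lower_bound_oriented[of "\<lambda>x y. \<not> f x y"] true assms unfolding cost_compl by blast
  qed
qed

end

subsection \<open>Graph parameters in terms of arcs\<close>

definition arcs :: "'a graph \<Rightarrow> ('a \<times> 'a) set" where
  "arcs F = {(x, y). {x, y} \<in> edges F}"

lemma edgeE:
  assumes "finite_simple_graph F" "a \<in> edges F"
  obtains x y where "a = {x, y}" "x \<in> verts F" "y \<in> verts F" "x \<noteq> y"
  using assms unfolding finite_simple_graph_def by blast

lemma arcs_verts:
  assumes "finite_simple_graph F" "(x, y) \<in> arcs F"
  shows "x \<in> verts F" "y \<in> verts F" "x \<noteq> y"
proof -
  have "{x, y} \<in> edges F" using assms(2) by (simp add: arcs_def)
  from edgeE[OF assms(1) this] obtain u v where "{x, y} = {u, v}" "u \<in> verts F" "v \<in> verts F" "u \<noteq> v" .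
  then show "x \<in> verts F" "y \<in> verts F" "x \<noteq> y" by (auto simp: doubleton_eq_iff)
qed

lemma arc_graph_arcs:
  assumes "finite_simple_graph F"
  shows "arc_graph (verts F) (arcs F)"
proof
  show "finite (verts F)" using assms by (simp add: finite_simple_graph_def)
  show "arcs F \<subseteq> verts F \<times> verts F" using arcs_verts[OF assms] by auto
  show "sym (arcs F)" by (auto simp: sym_def arcs_def insert_commute)
  show "irrefl (arcs F)" using arcs_verts(3)[OF assms] by (auto simp: irrefl_def)
qed

lemma finite_edges:
  assumes "finite_simple_graph F"
  shows "finite (edges F)"
  by (rule finite_subset[of _ "Pow (verts F)"])
     (use assms in \<open>auto simp: finite_simple_graph_def\<close>)

text \<open>Forgetting the orientation has fibres of size exactly 2, since there are no
  loops.\<close>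

lemma card_arcs_of_edges:
  assumes F: "finite_simple_graph F" and S: "S \<subseteq> edges F"
  shows "card {(x, y). {x, y} \<in> S} = 2 * card S"
proof -
  let ?f = "\<lambda>a. {z. {fst z, snd z} = a}"
  have fib: "finite (?f a) \<and> card (?f a) = 2" if a: "a \<in> S" for a
  proof -
    have "a \<in> edges F" using a S by blast
    then obtain x y where xy: "a = {x, y}" "x \<noteq> y" by (rule edgeE[OF F])
    have "?f a = {(x, y), (y, x)}"
      unfolding xy(1) doubleton_eq_iff by (auto simp: prod_eq_iff)
    then show ?thesis using xy(2) by simp
  qed
  have "{(x, y). {x, y} \<in> S} = (\<Union>a\<in>S. ?f a)"
    by (intro set_eqI) (simp add: split_def)
  also have "card \<dots> = (\<Sum>a\<in>S. card (?f a))"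
  proof (rule card_UN_disjoint)
    show "finite S" using S finite_edges[OF F] by (rule finite_subset)
    show "\<forall>a\<in>S. finite (?f a)" using fib by simp
    show "\<forall>a\<in>S. \<forall>b\<in>S. a \<noteq> b \<longrightarrow> ?f a \<inter> ?f b = {}"
      by (simp add: disjoint_iff)
  qed
  also have "\<dots> = (\<Sum>a\<in>S. 2)" by (rule sum.cong) (use fib in simp_all)
  finally show ?thesis by simp
qed

lemma card_arcs: "finite_simple_graph F \<Longrightarrow> card (arcs F) = 2 * card (edges F)"
  unfolding arcs_def using card_arcs_of_edges[of F "edges F"] by simp

text \<open>Orienting cut edges out of \<open>A\<close> is a bijection, so no factor 2
  appears.\<close>

lemma card_cut_edges:
  assumes F: "finite_simple_graph F"
  shows "card (cut_edges F A (verts F - A)) = card (boundary (arcs F) A)"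
proof -
  have "bij_betw (\<lambda>(x, y). {x, y}) (boundary (arcs F) A) (cut_edges F A (verts F - A))"
  proof (rule bij_betw_imageI)
    show "inj_on (\<lambda>(x, y). {x, y}) (boundary (arcs F) A)"
      by (auto simp: inj_on_def boundary_def doubleton_eq_iff)
    show "(\<lambda>(x, y). {x, y}) ` boundary (arcs F) A = cut_edges F A (verts F - A)" (is "?l = ?r")
    proof
      show "?l \<subseteq> ?r" using arcs_verts[OF F] by (auto simp: boundary_def cut_edges_def arcs_def)
      show "?r \<subseteq> ?l"
      proof
        fix a assume a: "a \<in> ?r"
        then have "a \<in> edges F" by (simp add: cut_edges_def)
        then obtain u v where uv: "a = {u, v}" using edgeE[OF F] by blast
        obtain x y where "x \<in> a" "x \<in> A" "y \<in> a" "y \<notin> A" using a unfolding cut_edges_def by fast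
        moreover from this have "x \<noteq> y" by blast
        ultimately have "a = {x, y}" using uv by fast
        then have "(x, y) \<in> boundary (arcs F) A" 
          using \<open>a \<in> edges F\<close> \<open>x \<in> A\<close> \<open>y \<notin> A\<close> by (simp add: boundary_def arcs_def)
        then show "a \<in> ?l" using \<open>a = {x, y}\<close> by force
      qed
    qed
  qed
  then show ?thesis by (simp add: bij_betw_same_card)
qed

section \<open>Edge connectivity as a minimum over vertex sets\<close>

lemma edge_conn_le:
  assumes F: "finite_simple_graph F" and x: "x \<in> verts F" "x \<in> A" and y: "y \<in> verts F" "y \<notin> A"
  shows "edge_conn F \<le> card (boundary (arcs F) A)"
proof -
  \<comment> \<open>Two distinct vertices exclude the default value 0 of
    \<open>edge_conn\<close>.\<close>
  have "card {x, y} \<le> card (verts F)"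
    using F x y by (intro card_mono) (auto simp: finite_simple_graph_def)
  then have c: "\<not> card (verts F) \<le> 1" using x y by (auto simp: card_insert_if split: if_splits)
  let ?S = "cut_edges F A (verts F - A)"
  let ?F = "(verts F, edges F - ?S)"
  have "z \<in> A" if "(adj ?F)\<^sup>*\<^sup>* x z" for z
    using that
  proof induction
    case (step u v)
    then have "(u, v) \<in> arcs F" "{u, v} \<notin> ?S" "{u, v} \<in> edges F" by (auto simp: adj_def arcs_def)
    then show ?case using step.IH arcs_verts[OF F] by (auto simp: cut_edges_def)
  qed (rule x)
  then have "\<not> connected_graph ?F" using x y by (auto simp: connected_graph_def)
  then have "card ?S \<in> {card S | S. S \<subseteq> edges F \<and> \<not> connected_graph (verts F, edges F - S)}"
    by (auto simp: cut_edges_def)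
  moreover have "finite {card S | S. S \<subseteq> edges F \<and> \<not> connected_graph (verts F, edges F - S)}"
    using finite_edges[OF F] by simp
  ultimately show ?thesis using c card_cut_edges[OF F, of A] by (simp add: edge_conn_def)
qed

lemma edge_conn_attained:
  assumes F: "finite_simple_graph F" and c: "1 < card (verts F)"
  obtains A where "A \<subseteq> verts F" "A \<noteq> {}" "A \<noteq> verts F" "edge_conn F = card (boundary (arcs F) A)"
proof -
  let ?M = "{card S | S. S \<subseteq> edges F \<and> \<not> connected_graph (verts F, edges F - S)}"
  have fin: "finite ?M" using finite_edges[OF F] by simp
  have "\<not> verts F \<subseteq> {v}" for v
    using c card_mono[of "{v}" "verts F"] by auto
  moreover obtain v where v: "v \<in> verts F" using F by (auto simp: finite_simple_graph_def)
  ultimately obtain w where w: "w \<in> verts F" "w \<noteq> v" by blast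
  have "(adj (verts F, {}))\<^sup>*\<^sup>* v z \<Longrightarrow> z = v" for z
    by (induction rule: rtranclp_induct) (auto simp: adj_def)
  then have "\<not> connected_graph (verts F, edges F - edges F)" using v w by (auto simp: connected_graph_def)
  then have "?M \<noteq> {}" by blast
  then have "edge_conn F \<in> ?M" using Min_in[OF fin] c by (simp add: edge_conn_def)
  then obtain S where S: "edge_conn F = card S" "S \<subseteq> edges F" "\<not> connected_graph (verts F, edges F - S)"
    by blast
  then obtain x y where xy: "x \<in> verts F" "y \<in> verts F" "\<not> (adj (verts F, edges F - S))\<^sup>*\<^sup>* x y"
    by (auto simp: connected_graph_def)
  \<comment> \<open>The component of \<open>x\<close> after deletion of a minimum cut
    \<open>S\<close>: all edges leaving it lie in \<open>S\<close>.\<close>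
  define A where "A = {z \<in> verts F. (adj (verts F, edges F - S))\<^sup>*\<^sup>* x z}"
  have "cut_edges F A (verts F - A) \<subseteq> S"
  proof
    fix a assume a: "a \<in> cut_edges F A (verts F - A)"
    then have "a \<in> edges F" by (simp add: cut_edges_def)
    then obtain p q where pq: "a = {p, q}" using edgeE[OF F] by blast
    obtain u v where uv: "u \<in> a" "u \<in> A" "v \<in> a" "v \<in> verts F" "v \<notin> A"
      using a unfolding cut_edges_def by fast
    then have "u \<noteq> v" by blast
    then have "a = {u, v}" using pq uv by fast
    show "a \<in> S"
    proof (rule ccontr)
      assume "a \<notin> S"
      then have "adj (verts F, edges F - S) u v" using \<open>a \<in> edges F\<close> \<open>a = {u, v}\<close> by (simp add: adj_def)
      then have "(adj (verts F, edges F - S))\<^sup>*\<^sup>* x v"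
        using uv(2) unfolding A_def by (blast intro: rtranclp.rtrancl_into_rtrancl)
      then have "v \<in> A" using uv(4) by (simp add: A_def)
      then show False using uv by simp
    qed
  qed
  then have "card (boundary (arcs F) A) \<le> edge_conn F"
    using card_mono[of S] S finite_edges[OF F] finite_subset card_cut_edges[OF F] by metis
  moreover have "edge_conn F \<le> card (boundary (arcs F) A)"
    by (rule edge_conn_le[OF F, of x _ y]) (use xy in \<open>auto simp: A_def\<close>)
  ultimately show thesis
    using that[of A] xy by (auto simp: A_def)
qed

section \<open>Frustration and \<open>rho\<close> as minima over 2-colourings\<close>

lemma frustration_le:
  assumes F: "finite_simple_graph F"
  shows "2 * frustration F \<le> card (mono_arcs (arcs F) (verts F) g)"
proof -
  define S where "S = {a \<in> edges F. \<exists>x y. a = {x, y} \<and> g x = g y}"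
  let ?M = "{card S | S. S \<subseteq> edges F \<and> bipartite (verts F, edges F - S)}"
  have "card (a \<inter> {x \<in> verts F. g x}) = 1" if a: "a \<in> edges F - S" for a
  proof -
    obtain x y where xy: "a = {x, y}" "x \<in> verts F" "y \<in> verts F" "x \<noteq> y" using edgeE[OF F] a by blast
    then have "g x \<noteq> g y" using a by (auto simp: S_def)
    then have "a \<inter> {x \<in> verts F. g x} = (if g x then {x} else {y})" using xy by auto
    then show ?thesis by simp
  qed
  then have "bipartite (verts F, edges F - S)"
    unfolding bipartite_def by (intro exI[of _ "{x \<in> verts F. g x}"]) auto
  then have "card S \<in> ?M" by (auto simp: S_def)
  then have "frustration F \<le> card S" unfolding frustration_def
    using finite_edges[OF F] by (intro Min_le) auto
  moreover have "{(x, y). {x, y} \<in> S} = mono_arcs (arcs F) (verts F) g"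
  proof -
    have "{x, y} \<in> S \<longleftrightarrow> (x, y) \<in> arcs F \<and> g x = g y" for x y
      unfolding S_def arcs_def by (auto simp: doubleton_eq_iff)
    then show ?thesis using arcs_verts[OF F] by (auto simp: mono_arcs_def)
  qed
  ultimately show ?thesis using card_arcs_of_edges[OF F, of S] by (simp add: S_def)
qed

text \<open>Colour by membership in one side of the bipartite remainder: monochromatic edges were
  all deleted, and \<open>frustration_le\<close> gives the converse inequality.\<close>

lemma frustration_attained:
  assumes F: "finite_simple_graph F"
  obtains g where "card (mono_arcs (arcs F) (verts F) g) = 2 * frustration F"
proof -
  let ?M = "{card S | S. S \<subseteq> edges F \<and> bipartite (verts F, edges F - S)}"
  have "bipartite (verts F, edges F - edges F)" by (auto simp: bipartite_def)
  then have "?M \<noteq> {}" by blast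
  then have "frustration F \<in> ?M" unfolding frustration_def using finite_edges[OF F] by (intro Min_in) auto
  then obtain S where S: "frustration F = card S" "S \<subseteq> edges F" "bipartite (verts F, edges F - S)" by blast
  then obtain A where A: "\<And>a. a \<in> edges F - S \<Longrightarrow> card (a \<inter> A) = 1"
    unfolding bipartite_def by fastforce
  let ?g = "\<lambda>x. x \<in> A"
  have "mono_arcs (arcs F) (verts F) ?g \<subseteq> {(x, y). {x, y} \<in> S}"
  proof (rule subrelI, rule ccontr)
    fix x y assume xy: "(x, y) \<in> mono_arcs (arcs F) (verts F) ?g" and "(x, y) \<notin> {(x, y). {x, y} \<in> S}"
    then have "card ({x, y} \<inter> A) = 1" by (intro A) (auto simp: mono_arcs_def arcs_def)
    moreover have "x \<noteq> y" "(x \<in> A) = (y \<in> A)" using xy arcs_verts(3)[OF F] by (auto simp: mono_arcs_def)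
    ultimately show False by (cases "y \<in> A") auto
  qed
  moreover have "finite {(x, y). {x, y} \<in> S}"
    by (rule finite_subset[OF _ arc_graph.finR[OF arc_graph_arcs[OF F]]]) (use S in \<open>auto simp: arcs_def\<close>)
  ultimately have "card (mono_arcs (arcs F) (verts F) ?g) \<le> card {(x, y). {x, y} \<in> S}"
    by (intro card_mono)
  then show thesis
    using that[of ?g] frustration_le[OF F, of ?g] card_arcs_of_edges[OF F S(2)] S(1) by linarith
qed

lemma finite_simple_graph_induced:
  assumes "finite_simple_graph F" "A \<subseteq> verts F" "A \<noteq> {}"
  shows "finite_simple_graph (induced F A)"
proof -
  have "a \<in> {{x, y} |x y. x \<in> A \<and> y \<in> A \<and> x \<noteq> y}" if a: "a \<in> edges F" "a \<subseteq> A" for a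
    using edgeE[OF assms(1) a(1)] a(2) by (smt (verit) insert_subset mem_Collect_eq)
  then show ?thesis
    using assms finite_subset by (auto simp: finite_simple_graph_def induced_def)
qed

lemma mono_arcs_induced: "mono_arcs (arcs (induced F A)) (verts (induced F A)) g = mono_arcs (arcs F) A g"
  by (auto simp: mono_arcs_def induced_def arcs_def)

lemma rho_le:
  assumes F: "finite_simple_graph F" and A: "A \<subseteq> verts F" "A \<noteq> {}"
  shows "rho F \<le> card (boundary (arcs F) A) + card (mono_arcs (arcs F) A g)"
proof -
  have "rho F \<le> 2 * frustration (induced F A) + card (cut_edges F A (verts F - A))"
    unfolding rho_def using A F by (intro Min_le) (auto simp: finite_simple_graph_def)
  then show ?thesis
    using frustration_le[OF finite_simple_graph_induced[OF F A], of g]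
    unfolding mono_arcs_induced card_cut_edges[OF F] by linarith
qed

lemma rho_attained:
  assumes F: "finite_simple_graph F"
  obtains A g where "A \<subseteq> verts F" "A \<noteq> {}"
    "card (boundary (arcs F) A) + card (mono_arcs (arcs F) A g) = rho F"
proof -
  have "rho F \<in> {2 * frustration (induced F A) + card (cut_edges F A (verts F - A))
               | A. A \<subseteq> verts F \<and> A \<noteq> {}}"
    unfolding rho_def using F by (intro Min_in) (auto simp: finite_simple_graph_def)
  then obtain A where A: "A \<subseteq> verts F" "A \<noteq> {}"
    "rho F = 2 * frustration (induced F A) + card (cut_edges F A (verts F - A))" by blast
  obtain g where "card (mono_arcs (arcs F) A g) = 2 * frustration (induced F A)"
    using frustration_attained[OF finite_simple_graph_induced[OF F A(1,2)]] unfolding mono_arcs_induced .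
  then show thesis using that[of A g] A card_cut_edges[OF F] by simp
qed

section \<open>Degrees\<close>

lemma degree_eq_card_arcs:
  assumes F: "finite_simple_graph F"
  shows "degree F x = card (arcs F `` {x})"
proof -
  have "bij_betw (\<lambda>y. {x, y}) (arcs F `` {x}) {a \<in> edges F. x \<in> a}"
  proof (rule bij_betw_imageI)
    show "inj_on (\<lambda>y. {x, y}) (arcs F `` {x})" by (auto simp: inj_on_def doubleton_eq_iff)
    show "(\<lambda>y. {x, y}) ` (arcs F `` {x}) = {a \<in> edges F. x \<in> a}"
    proof
      show "{a \<in> edges F. x \<in> a} \<subseteq> (\<lambda>y. {x, y}) ` (arcs F `` {x})"
      proof
        fix a assume a: "a \<in> {a \<in> edges F. x \<in> a}"
        then obtain u v where "a = {u, v}" using edgeE[OF F] by blast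
        then obtain y where "a = {x, y}" using a by (auto simp: insert_commute)
        then show "a \<in> (\<lambda>y. {x, y}) ` (arcs F `` {x})" using a by (auto simp: arcs_def)
      qed
    qed (auto simp: arcs_def)
  qed
  then show ?thesis by (simp add: degree_def bij_betw_same_card)
qed

lemma min_degree_le:
  "finite_simple_graph F \<Longrightarrow> x \<in> verts F \<Longrightarrow> min_degree F \<le> degree F x"
  unfolding min_degree_def finite_simple_graph_def by simp

lemma min_degree_attained:
  assumes "finite_simple_graph F"
  obtains x where "x \<in> verts F" "min_degree F = degree F x"
proof -
  have "min_degree F \<in> degree F ` verts F"
    unfolding min_degree_def using assms by (intro Min_in) (auto simp: finite_simple_graph_def)
  then show thesis using that by blast
qed

lemma boundary_singleton:
  "finite_simple_graph F \<Longrightarrow> card (boundary (arcs F) {x}) = degree F x"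
proof -
  assume F: "finite_simple_graph F"
  have "boundary (arcs F) {x} = Pair x ` (arcs F `` {x})"
    using arcs_verts(3)[OF F] by (auto simp: boundary_def)
  then show ?thesis by (simp add: degree_eq_card_arcs[OF F] card_image inj_on_def)
qed

section \<open>The direct product and its cuts\<close>

lemma finite_simple_graph_direct_product:
  assumes G: "finite_simple_graph G" and H: "finite_simple_graph H"
  shows "finite_simple_graph (direct_product G H)"
proof -
  have "a \<in> {{z, w} |z w. z \<in> verts G \<times> verts H \<and> w \<in> verts G \<times> verts H \<and> z \<noteq> w}"
    if a: "a \<in> edges (direct_product G H)" for a
  proof -
    obtain x1 x2 y1 y2 where "a = {(x1, y1), (x2, y2)}" "(x1, x2) \<in> arcs G" "(y1, y2) \<in> arcs H"
      using a by (auto simp: direct_product_def arcs_def)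
    then show ?thesis using arcs_verts[OF G] arcs_verts[OF H] by blast
  qed
  then have "edges (direct_product G H) \<subseteq>
      {{z, w} |z w. z \<in> verts G \<times> verts H \<and> w \<in> verts G \<times> verts H \<and> z \<noteq> w}" by (rule subsetI)
  moreover have "verts (direct_product G H) = verts G \<times> verts H" by (simp add: direct_product_def)
  ultimately show ?thesis using G H unfolding finite_simple_graph_def by simp
qed

lemma arcs_direct_product:
  "((x, y), (x', y')) \<in> arcs (direct_product G H) \<longleftrightarrow> (x, x') \<in> arcs G \<and> (y, y') \<in> arcs H"
  unfolding arcs_def direct_product_def by (auto simp: doubleton_eq_iff insert_commute)

lemma degree_direct_product:
  assumes "finite_simple_graph G" "finite_simple_graph H"
  shows "degree (direct_product G H) (x, y) = degree G x * degree H y"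
proof -
  have "arcs (direct_product G H) `` {(x, y)} = (arcs G `` {x}) \<times> (arcs H `` {y})"
    by (auto simp: arcs_direct_product)
  then show ?thesis
    using assms by (simp add: degree_eq_card_arcs finite_simple_graph_direct_product card_cartesian_product)
qed

text \<open>Pairs of arcs correspond to arcs of the product. The factor 2 arises because
  \<open>cost\<close> sees both orientations of a cut edge.\<close>

lemma cost_eq_boundary:
  assumes G: "finite_simple_graph G" and H: "finite_simple_graph H"
  shows "cost (arcs G) (arcs H) f = 2 * card (boundary (arcs (direct_product G H)) {(x, y). f x y})"
proof -
  let ?P = "arcs (direct_product G H)"
  interpret P: arc_graph "verts (direct_product G H)" ?P
    by (rule arc_graph_arcs[OF finite_simple_graph_direct_product[OF G H]])
  interpret H: arc_graph "verts H" "arcs H" by (rule arc_graph_arcs[OF H])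
  have "2 * card (boundary ?P {(x, y). f x y}) =
    (\<Sum>(z, w)\<in>?P. of_bool (f (fst z) (snd z) \<noteq> f (fst w) (snd w)))"
    unfolding boundary_def two_card_arcs[OF P.finR P.symR]
    by (rule sum.cong) auto
  also have "\<dots> = (\<Sum>((x, x'), (y, y'))\<in>arcs G \<times> arcs H. of_bool (f x y \<noteq> f x' y'))"
    by (rule sum.reindex_bij_witness[where j = "\<lambda>((x, y), (x', y')). ((x, x'), (y, y'))"
          and i = "\<lambda>((x, x'), (y, y')). ((x, y), (x', y'))"])
       (auto simp: arcs_direct_product)
  also have "\<dots> = cost (arcs G) (arcs H) f"
    unfolding cost_eq_double_sum[OF H.finR] split_def sum.cartesian_product ..
  finally show ?thesis by simp
qed

subsection \<open>The edge connectivity of a direct product\<close>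

text \<open>A lower bound for all nontrivial cuts, stated through \<open>cost\<close> so that the
  factors can be exchanged without an isomorphism between the two products.\<close>

definition cut_bound :: "'a graph \<Rightarrow> 'b graph \<Rightarrow> nat \<Rightarrow> bool" where
  "cut_bound G H L \<longleftrightarrow> (\<forall>f. \<forall>x\<in>verts G. \<forall>y\<in>verts H. \<forall>x'\<in>verts G. \<forall>y'\<in>verts H.
     f x y \<longrightarrow> \<not> f x' y' \<longrightarrow> 2 * L \<le> cost (arcs G) (arcs H) f)"

lemma cut_boundD:
  assumes "cut_bound G H L" "x \<in> verts G" "y \<in> verts H" "x' \<in> verts G" "y' \<in> verts H"
    "f x y" "\<not> f x' y'"
  shows "2 * L \<le> cost (arcs G) (arcs H) f"
  using assms unfolding cut_bound_def by blast

lemma cut_bound_transpose: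
  assumes "finite_simple_graph G" "finite_simple_graph H" "cut_bound G H L"
  shows "cut_bound H G L"
  unfolding cut_bound_def
proof (intro allI ballI impI)
  fix f y x y' x'
  assume "y \<in> verts H" "x \<in> verts G" "y' \<in> verts H" "x' \<in> verts G" "f y x" "\<not> f y' x'"
  then have "2 * L \<le> cost (arcs G) (arcs H) (\<lambda>x y. f y x)"
    using cut_boundD[OF assms(3), of x y x' y' "\<lambda>x y. f y x"] by simp
  also have "\<dots> = cost (arcs H) (arcs G) f"
    using assms(1,2) by (intro cost_transpose arc_graph.finR[OF arc_graph_arcs])
  finally show "2 * L \<le> cost (arcs H) (arcs G) f" .
qed

lemma cut_bound_edge_conn:
  assumes G: "finite_simple_graph G" and H: "finite_simple_graph H"
  shows "cut_bound G H (edge_conn (direct_product G H))"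
  unfolding cut_bound_def
proof (intro allI ballI impI)
  fix f x y x' y'
  assume "x \<in> verts G" "y \<in> verts H" "x' \<in> verts G" "y' \<in> verts H" "f x y" "\<not> f x' y'"
  then have "edge_conn (direct_product G H) \<le> card (boundary (arcs (direct_product G H)) {(x, y). f x y})"
    by (intro edge_conn_le[OF finite_simple_graph_direct_product[OF G H], of "(x, y)" _ "(x', y')"])
       (auto simp: direct_product_def)
  then show "2 * edge_conn (direct_product G H) \<le> cost (arcs G) (arcs H) f"
    by (simp add: cost_eq_boundary[OF G H])
qed

lemma cost_cylinder:
  assumes "finite R" "sym R"
  shows "cost R Q (\<lambda>x y. x \<in> A) = 2 * card (boundary R A) * card Q"
proof -
  have "cost R Q (\<lambda>x y. x \<in> A) = (\<Sum>(x, x')\<in>R. (of_bool (x \<in> A \<and> x' \<notin> A) + of_bool (x' \<in> A \<and> x \<notin> A)) * card Q)"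
    unfolding cost_def discord_def by (rule sum.cong) auto
  also have "\<dots> = (\<Sum>(x, x')\<in>R. of_bool (x \<in> A \<and> x' \<notin> A) + of_bool (x' \<in> A \<and> x \<notin> A)) * card Q"
    unfolding sum_distrib_right split_def ..
  finally show ?thesis unfolding boundary_def two_card_arcs[OF assms] .
qed

lemma cut_bound_le_edge_conn:
  assumes G: "finite_simple_graph G" and H: "finite_simple_graph H"
    and L: "cut_bound G H L" and c: "1 < card (verts G)"
  shows "L \<le> 2 * edge_conn G * card (edges H)"
proof -
  interpret G: arc_graph "verts G" "arcs G" by (rule arc_graph_arcs[OF G])
  obtain A where A: "A \<subseteq> verts G" "A \<noteq> {}" "A \<noteq> verts G" "edge_conn G = card (boundary (arcs G) A)"
    by (rule edge_conn_attained[OF G c])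
  obtain x x' where x: "x \<in> verts G" "x \<in> A" "x' \<in> verts G" "x' \<notin> A" using A by blast
  obtain y where y: "y \<in> verts H" using H by (auto simp: finite_simple_graph_def)
  have "2 * L \<le> cost (arcs G) (arcs H) (\<lambda>x y. x \<in> A)"
    by (rule cut_boundD[OF L x(1) y x(3) y]) (use x in auto)
  also have "\<dots> = 2 * card (boundary (arcs G) A) * (2 * card (edges H))"
    unfolding cost_cylinder[OF G.finR G.symR] card_arcs[OF H] ..
  finally show ?thesis using A(4) by (simp add: mult.commute)
qed

text \<open>An arc of \<open>R\<close> leaving \<open>A\<close> and an arc of \<open>Q\<close> are discordant for exactly one of the two
  colourings; this is why they are averaged.\<close>

lemma cost_twisted_colourings:
  assumes R: "finite R" "sym R" and Q: "finite Q" "Q \<subseteq> U \<times> U"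
  shows "cost R Q (\<lambda>x y. x \<in> A \<and> g x = h y) + cost R Q (\<lambda>x y. x \<in> A \<and> g x \<noteq> h y)
    \<le> 2 * (card (boundary R A) + card (mono_arcs R A g)) * card Q + 2 * card (mono_arcs Q U h) * card R"
proof -
  define b m :: "'a \<times> 'a \<Rightarrow> nat" 
    where "b = (\<lambda>(x, x'). of_bool (x \<in> A \<and> x' \<notin> A) + of_bool (x' \<in> A \<and> x \<notin> A))"
      and "m = (\<lambda>(x, x'). of_bool (x \<in> A \<and> x' \<in> A \<and> g x = g x'))"
  define n :: "'b \<times> 'b \<Rightarrow> nat" where "n = (\<lambda>(y, y'). of_bool (y \<in> U \<and> y' \<in> U \<and> h y = h y'))"
  have b: "sum b R = 2 * card (boundary R A)"
    unfolding b_def boundary_def two_card_arcs[OF R] ..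
  have m: "sum m R = card (mono_arcs R A g)"
    unfolding m_def mono_arcs_def card_arcs_eq_sum[OF R(1)] ..
  have n: "sum n Q = card (mono_arcs Q U h)"
    unfolding n_def mono_arcs_def card_arcs_eq_sum[OF Q(1)] ..
  \<comment> \<open>For an arc inside \<open>A\<close> both colourings are discordant together,
    exactly when one of the two arcs is monochromatic and the other is not.\<close>
  have le: "of_bool ((x \<in> A \<and> g x = h y) \<noteq> (x' \<in> A \<and> g x' = h y'))
      + of_bool ((x \<in> A \<and> g x \<noteq> h y) \<noteq> (x' \<in> A \<and> g x' \<noteq> h y'))
      \<le> b (x, x') + 2 * m (x, x') + 2 * n (y, y')" if "(y, y') \<in> Q" for x x' y y'
  proof -
    have "y \<in> U" "y' \<in> U" using that Q by auto
    then show ?thesis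
      by (cases "x \<in> A"; cases "x' \<in> A"; cases "g x"; cases "g x'"; cases "h y"; cases "h y'";
          simp add: b_def m_def n_def)
  qed
  have "cost R Q (\<lambda>x y. x \<in> A \<and> g x = h y) + cost R Q (\<lambda>x y. x \<in> A \<and> g x \<noteq> h y)
    = (\<Sum>r\<in>R. \<Sum>c\<in>Q. of_bool ((fst r \<in> A \<and> g (fst r) = h (fst c)) \<noteq> (snd r \<in> A \<and> g (snd r) = h (snd c)))
      + of_bool ((fst r \<in> A \<and> g (fst r) \<noteq> h (fst c)) \<noteq> (snd r \<in> A \<and> g (snd r) \<noteq> h (snd c))))"
    unfolding cost_eq_double_sum[OF Q(1)] split_def sum.distrib ..
  also have "\<dots> \<le> (\<Sum>r\<in>R. \<Sum>c\<in>Q. b r + 2 * m r + 2 * n c)"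
  proof (intro sum_mono)
    fix r c assume "c \<in> Q"
    then show "of_bool ((fst r \<in> A \<and> g (fst r) = h (fst c)) \<noteq> (snd r \<in> A \<and> g (snd r) = h (snd c)))
      + of_bool ((fst r \<in> A \<and> g (fst r) \<noteq> h (fst c)) \<noteq> (snd r \<in> A \<and> g (snd r) \<noteq> h (snd c)))
      \<le> b r + 2 * m r + 2 * n c"
      using le[of "fst c" "snd c" "fst r" "snd r"] unfolding prod.collapse by blast
  qed
  also have "\<dots> = (sum b R + 2 * sum m R) * card Q + 2 * sum n Q * card R"
    by (simp add: sum.distrib sum_distrib_left[symmetric] sum_distrib_right[symmetric] algebra_simps)
  finally show ?thesis unfolding b m n by (simp add: algebra_simps)
qed

lemma cut_bound_le_psi:
  assumes G: "finite_simple_graph G" and H: "finite_simple_graph H"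
    and L: "cut_bound G H L" and ne: "arcs H \<noteq> {}"
  shows "L \<le> psi G H"
proof -
  interpret G: arc_graph "verts G" "arcs G" by (rule arc_graph_arcs[OF G])
  interpret H: arc_graph "verts H" "arcs H" by (rule arc_graph_arcs[OF H])
  obtain A g where A: "A \<subseteq> verts G" "A \<noteq> {}"
    "card (boundary (arcs G) A) + card (mono_arcs (arcs G) A g) = rho G"
    by (rule rho_attained[OF G])
  obtain h where h: "card (mono_arcs (arcs H) (verts H) h) = 2 * frustration H"
    by (rule frustration_attained[OF H])
  obtain u v where uv: "(u, v) \<in> arcs H" using ne by auto
  \<comment> \<open>An optimal \<open>h\<close> takes both values: a constant one leaves every arc
    monochromatic, whereas singling out \<open>u\<close> saves the arc \<open>(u, v)\<close>. This
    makes both test sets nontrivial.\<close>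
  have "\<exists>y\<in>verts H. \<exists>y'\<in>verts H. h y \<and> \<not> h y'"
  proof (rule ccontr)
    assume "\<not> ?thesis"
    then have "h y = h y'" if "y \<in> verts H" "y' \<in> verts H" for y y' using that by blast
    then have "mono_arcs (arcs H) (verts H) h = arcs H"
      using H.RV by (auto simp: mono_arcs_def)
    moreover have "mono_arcs (arcs H) (verts H) (\<lambda>y. y = u) \<subseteq> arcs H - {(u, v)}"
      using arcs_verts(3)[OF H uv] by (auto simp: mono_arcs_def)
    then have "card (mono_arcs (arcs H) (verts H) (\<lambda>y. y = u)) < card (arcs H)"
      using uv by (intro psubset_card_mono[OF H.finR]) blast
    ultimately show False
      using frustration_le[OF H, of "\<lambda>y. y = u"] h by simp
  qed
  then obtain y y' where y: "y \<in> verts H" "y' \<in> verts H" "h y" "\<not> h y'" by blast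
  obtain x where x: "x \<in> A" "x \<in> verts G" using A by blast
  have ex: "\<exists>w w'. w \<in> verts H \<and> w' \<in> verts H \<and> g x = h w \<and> g x \<noteq> h w'"
    using y by (cases "g x") auto
  then obtain w w' where w: "w \<in> verts H" "w' \<in> verts H" "g x = h w" "g x \<noteq> h w'" by blast
  have "2 * L \<le> cost (arcs G) (arcs H) (\<lambda>x y. x \<in> A \<and> g x = h y)"
    by (rule cut_boundD[OF L x(2) w(1) x(2) w(2)]) (use x w in simp_all)
  moreover have "2 * L \<le> cost (arcs G) (arcs H) (\<lambda>x y. x \<in> A \<and> g x \<noteq> h y)"
    by (rule cut_boundD[OF L x(2) w(2) x(2) w(1)]) (use x w in simp_all)
  ultimately have "4 * L \<le> 2 * rho G * card (arcs H) + 2 * (2 * frustration H) * card (arcs G)"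
    using cost_twisted_colourings[OF G.finR G.symR H.finR H.RV, of A g h] unfolding A(3) h by linarith
  then show ?thesis unfolding card_arcs[OF G] card_arcs[OF H] psi_def by simp
qed

lemma edge_conn_no_arcs:
  assumes F: "finite_simple_graph F" and "arcs F = {}"
  shows "edge_conn F = 0"
proof (cases "1 < card (verts F)")
  case True
  obtain A where "edge_conn F = card (boundary (arcs F) A)" by (rule edge_conn_attained[OF F True])
  then show ?thesis using assms(2) by (simp add: boundary_def)
qed (simp add: edge_conn_def)

lemma edge_conn_le_min_degree:
  assumes F: "finite_simple_graph F"
  shows "edge_conn F \<le> min_degree F"
proof -
  obtain x where x: "x \<in> verts F" "min_degree F = degree F x" by (rule min_degree_attained[OF F])
  show ?thesis
  proof (cases "verts F = {x}")
    case True
    then show ?thesis by (simp add: edge_conn_def)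
  next
    case False
    then obtain y where "y \<in> verts F" "y \<noteq> x" using x by blast
    then show ?thesis using edge_conn_le[OF F x(1), of "{x}" y] x boundary_singleton[OF F, of x] by simp
  qed
qed

lemma card_verts_gt_1:
  assumes F: "finite_simple_graph F" and "arcs F \<noteq> {}"
  shows "1 < card (verts F)"
proof -
  obtain u v where uv: "(u, v) \<in> arcs F" using assms(2) by auto
  have "card {u, v} \<le> card (verts F)"
    using F arcs_verts[OF F uv] by (intro card_mono) (auto simp: finite_simple_graph_def)
  then show ?thesis using arcs_verts(3)[OF F uv] by simp
qed

lemma edge_conn_le_boundary:
  assumes F: "finite_simple_graph F" and "A \<subseteq> verts F" "A \<noteq> {}" "A \<noteq> verts F"
  shows "edge_conn F \<le> card (boundary (arcs F) A)"
proof -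
  obtain x y where "x \<in> verts F" "x \<in> A" "y \<in> verts F" "y \<notin> A" using assms by blast
  then show ?thesis by (rule edge_conn_le[OF F])
qed

lemma connected_arc_graph_arcs:
  assumes F: "finite_simple_graph F" and "edge_conn F \<noteq> 0"
  shows "connected_arc_graph (verts F) (arcs F)"
proof -
  interpret arc_graph "verts F" "arcs F" by (rule arc_graph_arcs[OF F])
  show ?thesis
  proof
    fix A assume "A \<subseteq> verts F" "A \<noteq> {}" "A \<noteq> verts F"
    then have "edge_conn F \<le> card (boundary (arcs F) A)" by (rule edge_conn_le_boundary[OF F])
    then show "boundary (arcs F) A \<noteq> {}" using assms(2) by auto
  qed
qed

lemma bipartite_frustration:
  assumes "finite_simple_graph F" "mono_arcs (arcs F) (verts F) g = {}"
  shows "frustration F = 0"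
  using frustration_le[OF assms(1), of g] assms(2) by simp

lemma edge_conn_direct_product_le:
  assumes G: "finite_simple_graph G" and H: "finite_simple_graph H"
  shows "edge_conn (direct_product G H) \<le> 2 * edge_conn G * card (edges H)"
    "edge_conn (direct_product G H) \<le> 2 * edge_conn H * card (edges G)"
    "edge_conn (direct_product G H) \<le> psi G H" "edge_conn (direct_product G H) \<le> psi H G"
proof -
  let ?P = "direct_product G H"
  have P: "finite_simple_graph ?P" by (rule finite_simple_graph_direct_product[OF G H])
  note L = cut_bound_edge_conn[OF G H]
  note L' = cut_bound_transpose[OF G H L]
  \<comment> \<open>With an edgeless factor the left side is 0. Otherwise both factors have two
    vertices and the test cuts exist.\<close>
  have *: "edge_conn ?P = 0 \<or> arcs G \<noteq> {} \<and> arcs H \<noteq> {}"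
  proof (cases "arcs G = {} \<or> arcs H = {}")
    case True
    then have "arcs ?P = {}" using arcs_direct_product[of _ _ _ _ G H] by auto
    then show ?thesis using edge_conn_no_arcs[OF P] by simp
  qed simp
  show "edge_conn ?P \<le> 2 * edge_conn G * card (edges H)"
    using * cut_bound_le_edge_conn[OF G H L] card_verts_gt_1[OF G] by fastforce
  show "edge_conn ?P \<le> 2 * edge_conn H * card (edges G)"
    using * cut_bound_le_edge_conn[OF H G L'] card_verts_gt_1[OF H] by fastforce
  show "edge_conn ?P \<le> psi G H" using * cut_bound_le_psi[OF G H L] by fastforce
  show "edge_conn ?P \<le> psi H G" using * cut_bound_le_psi[OF H G L'] by fastforce
qed

text \<open>The general bound on \<open>cost\<close> is applied to a minimum cut of the product; the
  factors 2 from \<open>cost\<close> and from counting arcs cancel.\<close>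

lemma edge_conn_direct_product_ge:
  assumes G: "finite_simple_graph G" and H: "finite_simple_graph H"
  shows "2 * edge_conn G * card (edges H) \<le> edge_conn (direct_product G H) \<or>
    2 * edge_conn H * card (edges G) \<le> edge_conn (direct_product G H) \<or>
    min_degree (direct_product G H) \<le> edge_conn (direct_product G H) \<or>
    psi G H \<le> edge_conn (direct_product G H) \<or> psi H G \<le> edge_conn (direct_product G H)"
proof -
  let ?P = "direct_product G H"
  have P: "finite_simple_graph ?P" by (rule finite_simple_graph_direct_product[OF G H])
  obtain x0 where x0: "x0 \<in> verts G" "min_degree G = degree G x0" by (rule min_degree_attained[OF G])
  obtain y0 where y0: "y0 \<in> verts H" "min_degree H = degree H y0" by (rule min_degree_attained[OF H])
  have "(x0, y0) \<in> verts ?P" using x0 y0 by (simp add: direct_product_def)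
  then have deg: "min_degree ?P \<le> min_degree G * min_degree H"
    using min_degree_le[OF P] degree_direct_product[OF G H] x0 y0 by metis
  show ?thesis
  \<comment> \<open>If one of these is 0, so is one of the first three terms. Otherwise both factors
    are connected with positive minimum degree.\<close>
  proof (cases "edge_conn G = 0 \<or> edge_conn H = 0 \<or> min_degree G = 0 \<or> min_degree H = 0")
    case True
    then show ?thesis using deg by auto
  next
    case False
    interpret G: connected_arc_graph "verts G" "arcs G" by (rule connected_arc_graph_arcs[OF G]) (use False in simp)
    interpret H: connected_arc_graph "verts H" "arcs H" by (rule connected_arc_graph_arcs[OF H]) (use False in simp)
    interpret product_bounds "verts G" "arcs G" "verts H" "arcs H" "min_degree G" "min_degree H"
      "edge_conn G" "edge_conn H" "rho G" "rho H"
    proof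
      show "min_degree G \<le> card (arcs G `` {x})" if "x \<in> verts G" for x
        using min_degree_le[OF G that] degree_eq_card_arcs[OF G] by simp
      show "min_degree H \<le> card (arcs H `` {x})" if "x \<in> verts H" for x
        using min_degree_le[OF H that] degree_eq_card_arcs[OF H] by simp
      show "1 \<le> min_degree G" "1 \<le> min_degree H" using False by simp_all
    qed (fact edge_conn_le_boundary[OF G] edge_conn_le_boundary[OF H] rho_le[OF G] rho_le[OF H])+
    have "1 < card (verts G)" using False by (auto simp: edge_conn_def split: if_splits)
    moreover have "card (verts ?P) = card (verts G) * card (verts H)"
      by (simp add: direct_product_def card_cartesian_product)
    moreover have "0 < card (verts H)" using y0 H.finV card_gt_0_iff by blast
    ultimately have "1 < card (verts ?P)" by (metis less_1_mult less_one linorder_neqE_nat mult.right_neutral not_less0)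
    then obtain A where A: "A \<subseteq> verts ?P" "A \<noteq> {}" "A \<noteq> verts ?P" "edge_conn ?P = card (boundary (arcs ?P) A)"
      by (rule edge_conn_attained[OF P])
    define f where "f x y \<longleftrightarrow> (x, y) \<in> A" for x y
    have "{(x, y). f x y} = A" by (auto simp: f_def)
    then have cost: "cost (arcs G) (arcs H) f = 2 * edge_conn ?P"
      unfolding cost_eq_boundary[OF G H] A(4) by simp
    obtain x y where xy: "x \<in> verts G" "y \<in> verts H" "f x y"
      using A(1,2) by (auto simp: f_def direct_product_def)
    obtain x' y' where xy': "x' \<in> verts G" "y' \<in> verts H" "\<not> f x' y'"
      using A(1,3) by (auto simp: f_def direct_product_def)
    have "2 * edge_conn G * card (edges H) \<le> edge_conn ?P \<or>
      2 * edge_conn H * card (edges G) \<le> edge_conn ?P \<or> min_degree G * min_degree H \<le> edge_conn ?P \<or>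
      (\<exists>h. mono_arcs (arcs H) (verts H) h = {}) \<and> rho G * card (edges H) \<le> edge_conn ?P \<or>
      (\<exists>g. mono_arcs (arcs G) (verts G) g = {}) \<and> rho H * card (edges G) \<le> edge_conn ?P"
      using cost_lower_bound[OF xy xy'] unfolding cost card_arcs[OF G] card_arcs[OF H]
      by (simp add: mult.assoc mult.left_commute)
    \<comment> \<open>A proper 2-colouring makes the frustration 0, which reduces \<open>psi\<close>
      to its \<open>rho\<close> term.\<close>
    then show ?thesis
      using deg bipartite_frustration[OF H] bipartite_frustration[OF G] by (auto simp: psi_def)
  qed
qed

theorem theorem1p1:
  fixes G :: "'a graph" and H :: "'b graph"
  assumes "finite_simple_graph G" and "finite_simple_graph H"
  shows "edge_conn (direct_product G H) =
    Min {2 * edge_conn G * card (edges H), 2 * edge_conn H * card (edges G),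
         min_degree (direct_product G H), psi G H, psi H G}"
proof (rule antisym)
  show "edge_conn (direct_product G H) \<le>
    Min {2 * edge_conn G * card (edges H), 2 * edge_conn H * card (edges G),
         min_degree (direct_product G H), psi G H, psi H G}"
    using edge_conn_direct_product_le[OF assms]
      edge_conn_le_min_degree[OF finite_simple_graph_direct_product[OF assms]] by simp
  show "Min {2 * edge_conn G * card (edges H), 2 * edge_conn H * card (edges G),
         min_degree (direct_product G H), psi G H, psi H G} \<le> edge_conn (direct_product G H)"
    using edge_conn_direct_product_ge[OF assms] by (auto simp: min_le_iff_disj)
qed

end
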